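(* Assume that $a_{ij}>0$ for all $i\in N$, $j\in M$ (MAC). Consider the following algorithm on the graph $\mathcal G=(V,E)$. Start from any $v^0\in V$. Given the current $v^k\in V$, compute $\tilde g(v')$ for every vertex $v'$ adjacent to $v^k$. If $\tilde g(v^k)\le\tilde g(v')$ for every $v'$ adjacent to $v^k$, stop, and output $v^k$ as optimal; otherwise let $v^{k+1}$ be an adjacent vertex with the lowest value of $\tilde g$, and repeat with $v^{k+1}$. Then, for every starting vertex, the algorithm converges in a finite number of steps, i.e. it stops after finitely many steps at an optimal vertex $v^k$ (one whose Pareto face $F_{v^k}$ contains a point of the egalitarian ray).
   Context: Setting. $N=\{1,2,3\}$ is the set of players and $M=\{1,\dots,m\}$ ($m\ge1$) the set of divisible homogeneous goods (items). $a_{ij}$ is the value of good $j$ to player $i$, with $\sum_{j\in M}a_{ij}=1$ for each $i$. An allocation is a matrix $\mathbf X=(x_{ij})_{i\in N,j\in M}$ with $x_{ij}\ge0$ and $\sum_{i\in N}x_{ij}=1$ for all $j$. Put $a_i(\mathbf X)=\sum_{j}a_{ij}x_{ij}$ and $a(\mathbf X)=(a_i(\mathbf X))_{i\in N}\in\mathbb R^3$. $IPS=\{a(\mathbf X):\mathbf X\text{ an allocation}\}$. The egalitarian ray is $\{t(1,1,1):t\ge0\}$. $\Delta_2=\{x\in\mathbb R^3: x_i\ge0,\ x_1+x_2+x_3=1\}$, and $\mathring\Delta_2$ is the subset with all $x_i>0$. For $x\in\mathbb R^3_+\setminus\{0\}$, $N(x)=x/(x_1+x_2+x_3)$. For $x\in\mathring\Delta_2$,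 $RD(x)=N(1/x_1,1/x_2,1/x_3)$. For $\gamma\in\Delta_2$, $g(\gamma)=\max_{y\in IPS}\sum_i\gamma_iy_i=\sum_{j\in M}\max_{i\in N}\gamma_ia_{ij}$, and $\mathcal H(\gamma)=\{x\in\mathbb R^3:\sum_i\gamma_ix_i=g(\gamma)\}$. For $\beta\in\mathring\Delta_2$, $\tilde g(\beta)=g(RD(\beta))$. $RNS$ is the simplex $\Delta_2$, in which the vertex $e_i$ represents player $i$ and each good $j$ is plotted at $a^n_j=N(a_{1j},a_{2j},a_{3j})$. The supporting segments of a good $j$ are the three segments joining $a^n_j$ to the three vertices of the simplex. Two goods are s-independent if neither of their plotted points lies on a supporting segment of the other. The graph $\mathcal G=(V,E)$: $V$ is the set of points of $RNS$ that coincide with some $a^n_j$, or are an intersection point, other than a vertex of the simplex, of supporting segments of two s-independent goods. Two distinct points of $V$ are joined by an arc (are adjacent) if both lie on a common supporting segment of some good with no other point of $V$ strictly between them. Each $v\in V$ represents the Pareto face $F_v=IPS\cap\mathcal H(RD(v))$ (a two-dimensional face of $IPS$ made of values of Pareto optimal allocations). *)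

theory Defs
  imports "HOL-Analysis.Analysis"
begin

text \<open>
  Players are the elements of the three-element type \<open>3\<close>; goods are the elements of an
  arbitrary finite (hence nonempty) type \<open>'m\<close>. A value matrix \<open>a\<close> and an allocation \<open>X\<close>
  have type \<open>real^'m^3\<close>, with the entry of player \<open>i\<close> and good \<open>j\<close> written \<open>a $ i $ j\<close>.
\<close>

definition allocation :: "real^'m^3 \<Rightarrow> bool" where
  "allocation X \<longleftrightarrow> (\<forall>i j. 0 \<le> X $ i $ j) \<and> (\<forall>j. (\<Sum>i\<in>UNIV. X $ i $ j) = 1)"

definition valuation :: "real^'m^3 \<Rightarrow> real^'m^3 \<Rightarrow> real^3" where
  "valuation a X = (\<chi> i. \<Sum>j\<in>UNIV. a $ i $ j * X $ i $ j)"

definition IPS :: "real^'m^3 \<Rightarrow> (real^3) set" where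
  "IPS a = {valuation a X |X. allocation X}"

definition egalitarian_ray :: "(real^3) set" where
  "egalitarian_ray = {t *\<^sub>R (\<chi> i. 1) |t. 0 \<le> t}"

definition RNS :: "(real^3) set" where
  "RNS = {x. (\<forall>i. 0 \<le> x $ i) \<and> (\<Sum>i\<in>UNIV. x $ i) = 1}"

definition normalize_vec :: "real^3 \<Rightarrow> real^3" where
  "normalize_vec x = x /\<^sub>R (\<Sum>i\<in>UNIV. x $ i)"

text \<open>Only meaningful where all coordinates are positive; every vertex of the graph below is
  such a point when all values are positive.\<close>

definition RD :: "real^3 \<Rightarrow> real^3" where
  "RD x = normalize_vec (\<chi> i. 1 / x $ i)"

text \<open>The supremum is a maximum, and it has the usual closed form: see \<open>g_attained\<close>
  and \<open>g_eq_sum_Max\<close>.\<close>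

definition g :: "real^'m^3 \<Rightarrow> real^3 \<Rightarrow> real" where
  "g a \<gamma> = (SUP y\<in>IPS a. \<gamma> \<bullet> y)"

definition g_tilde :: "real^'m^3 \<Rightarrow> real^3 \<Rightarrow> real" where
  "g_tilde a \<beta> = g a (RD \<beta>)"

definition supp_hyperplane :: "real^'m^3 \<Rightarrow> real^3 \<Rightarrow> (real^3) set" where
  "supp_hyperplane a \<gamma> = {x. \<gamma> \<bullet> x = g a \<gamma>}"

definition good_point :: "real^'m^3 \<Rightarrow> 'm \<Rightarrow> real^3" where
  "good_point a j = normalize_vec (column j a)"

definition supp_segment :: "real^'m^3 \<Rightarrow> 'm \<Rightarrow> 3 \<Rightarrow> (real^3) set" where
  "supp_segment a j i = closed_segment (good_point a j) (axis i 1)"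

definition s_independent :: "real^'m^3 \<Rightarrow> 'm \<Rightarrow> 'm \<Rightarrow> bool" where
  "s_independent a j k \<longleftrightarrow>
     (\<forall>i. good_point a j \<notin> supp_segment a k i) \<and> (\<forall>i. good_point a k \<notin> supp_segment a j i)"

definition graph_verts :: "real^'m^3 \<Rightarrow> (real^3) set" where
  "graph_verts a = {p \<in> RNS. (\<exists>j. p = good_point a j) \<or>
     (\<exists>j k i l. s_independent a j k \<and> p \<in> supp_segment a j i \<inter> supp_segment a k l
        \<and> (\<forall>h. p \<noteq> axis h 1))}"

definition graph_adj :: "real^'m^3 \<Rightarrow> real^3 \<Rightarrow> real^3 \<Rightarrow> bool" where
  "graph_adj a u v \<longleftrightarrow> u \<in> graph_verts a \<and> v \<in> graph_verts a \<and> u \<noteq> v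
     \<and> (\<exists>j i. u \<in> supp_segment a j i \<and> v \<in> supp_segment a j i)
     \<and> open_segment u v \<inter> graph_verts a = {}"

definition pareto_face :: "real^'m^3 \<Rightarrow> real^3 \<Rightarrow> (real^3) set" where
  "pareto_face a v = IPS a \<inter> supp_hyperplane a (RD v)"

definition optimal_vertex :: "real^'m^3 \<Rightarrow> real^3 \<Rightarrow> bool" where
  "optimal_vertex a v \<longleftrightarrow> v \<in> graph_verts a \<and> pareto_face a v \<inter> egalitarian_ray \<noteq> {}"

definition alg_stops :: "real^'m^3 \<Rightarrow> real^3 \<Rightarrow> bool" where
  "alg_stops a v \<longleftrightarrow> (\<forall>v'. graph_adj a v v' \<longrightarrow> g_tilde a v \<le> g_tilde a v')"

text \<open>A relation rather than a function, because several adjacent vertices may tie for the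
  lowest value; each of them is an admissible successor.\<close>

definition alg_step :: "real^'m^3 \<Rightarrow> real^3 \<Rightarrow> real^3 \<Rightarrow> bool" where
  "alg_step a v w \<longleftrightarrow> \<not> alg_stops a v \<and> graph_adj a v w
     \<and> (\<forall>v'. graph_adj a v v' \<longrightarrow> g_tilde a w \<le> g_tilde a v')"

lemma inner_valuation:
  "\<gamma> \<bullet> valuation a X = (\<Sum>j\<in>UNIV. \<Sum>i\<in>UNIV. (\<gamma> $ i * a $ i $ j) * X $ i $ j)"
  unfolding valuation_def inner_vec_def
  by (subst sum.swap) (simp add: sum_distrib_left mult.assoc)

lemma inner_IPS_le:
  assumes "y \<in> IPS a"
  shows "\<gamma> \<bullet> y \<le> (\<Sum>j\<in>UNIV. MAX i. \<gamma> $ i * a $ i $ j)"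
proof -
  obtain X where y: "y = valuation a X" and X: "allocation X"
    using assms unfolding IPS_def by blast
  have "(\<Sum>i\<in>UNIV. (\<gamma> $ i * a $ i $ j) * X $ i $ j) \<le> (MAX i. \<gamma> $ i * a $ i $ j)" for j
  proof -
    have "(\<Sum>i\<in>UNIV. (\<gamma> $ i * a $ i $ j) * X $ i $ j)
        \<le> (\<Sum>i\<in>UNIV. (MAX i. \<gamma> $ i * a $ i $ j) * X $ i $ j)"
      using X by (intro sum_mono mult_right_mono) (auto simp: allocation_def)
    also have "\<dots> = (MAX i. \<gamma> $ i * a $ i $ j)"
      using X by (simp add: sum_distrib_left[symmetric] allocation_def)
    finally show ?thesis .
  qed
  then show ?thesis unfolding y inner_valuation by (rule sum_mono)
qed

lemma inner_IPS_attained: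
  "\<exists>y\<in>IPS a. \<gamma> \<bullet> y = (\<Sum>j\<in>UNIV. MAX i. \<gamma> $ i * a $ i $ j)"
proof -
  have "\<forall>j. \<exists>i. (MAX i. \<gamma> $ i * a $ i $ j) = \<gamma> $ i * a $ i $ j"
  proof
    fix j
    have "(MAX i. \<gamma> $ i * a $ i $ j) \<in> range (\<lambda>i. \<gamma> $ i * a $ i $ j)"
      by (rule Max_in) simp_all
    then show "\<exists>i. (MAX i. \<gamma> $ i * a $ i $ j) = \<gamma> $ i * a $ i $ j" by (rule rangeE) (rule exI)
  qed
  from choice[OF this]
  obtain f where f: "(MAX i. \<gamma> $ i * a $ i $ j) = \<gamma> $ f j * a $ f j $ j" for j
    by (elim exE) simp
  define X :: "real^'a^3" where "X = (\<chi> i j. if i = f j then 1 else 0)"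
  have "allocation X" by (simp add: X_def allocation_def)
  moreover have "\<gamma> \<bullet> valuation a X = (\<Sum>j\<in>UNIV. MAX i. \<gamma> $ i * a $ i $ j)"
    unfolding inner_valuation
  proof (rule sum.cong[OF refl])
    fix j
    have "(\<Sum>i\<in>UNIV. (\<gamma> $ i * a $ i $ j) * X $ i $ j)
        = (\<Sum>i\<in>UNIV. if i = f j then \<gamma> $ i * a $ i $ j else 0)"
      by (rule sum.cong) (simp_all add: X_def)
    also have "\<dots> = \<gamma> $ f j * a $ f j $ j" by (subst sum.delta) simp_all
    finally show "(\<Sum>i\<in>UNIV. (\<gamma> $ i * a $ i $ j) * X $ i $ j) = (MAX i. \<gamma> $ i * a $ i $ j)"
      by (simp only: f)
  qed
  ultimately show ?thesis unfolding IPS_def by blast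
qed

lemma g_eq_sum_Max: "g a \<gamma> = (\<Sum>j\<in>UNIV. MAX i. \<gamma> $ i * a $ i $ j)"
proof -
  have "(\<Sum>j\<in>UNIV. MAX i. \<gamma> $ i * a $ i $ j) \<in> (\<lambda>y. \<gamma> \<bullet> y) ` IPS a"
    using inner_IPS_attained[of a \<gamma>] by (elim bexE) (erule rev_image_eqI, rule sym)
  then show ?thesis
    unfolding g_def
  proof (rule cSup_eq_maximum)
    fix z assume "z \<in> (\<lambda>y. \<gamma> \<bullet> y) ` IPS a"
    then show "z \<le> (\<Sum>j\<in>UNIV. MAX i. \<gamma> $ i * a $ i $ j)"
      by (rule imageE) (simp only: inner_IPS_le)
  qed
qed

lemma g_attained: "\<exists>y\<in>IPS a. \<gamma> \<bullet> y = g a \<gamma>"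
  unfolding g_eq_sum_Max by (rule inner_IPS_attained)

end

theory Submission
  imports Defs
begin

text \<open>
  In the coordinates \<open>\<gamma> = 1 / \<beta>\<close>, considered up to scaling, a point \<open>\<beta>\<close> lies on the supporting
  segment of good \<open>j\<close> towards vertex \<open>m\<close> iff both players other than \<open>m\<close> attain the maximum of
  \<open>\<gamma>\<^sub>i a\<^sub>i\<^sub>j\<close>. So the supporting segments form the locus where the convex piecewise linear
  function \<open>g\<close> is not smooth, and moving along a segment changes a single coordinate of \<open>\<gamma>\<close>.

  Let \<open>t = g_tilde a v\<close>. If \<open>g \<delta> \<ge> t * (\<Sum>i. \<delta>\<^sub>i)\<close> for all positive \<open>\<delta>\<close>, then \<open>(t,t,t)\<close>
  lies in \<open>IPS\<close>, and so on the Pareto face of \<open>v\<close>: a hyperplane separating it from the compact convex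
  set \<open>IPS\<close> would give a positive \<open>\<delta>\<close> near \<open>1 / v\<close> violating the inequality. Otherwise \<open>g - t * \<Sum>\<close> has a direction of descent at \<open>1 / v\<close>. Its directional
  derivative there is linear on each cone cut out by the segments through \<open>v\<close>, hence some segment
  leaving \<open>v\<close> is itself a direction of descent. As \<open>g\<close> is linear between consecutive vertices of
  the graph on a segment, the next vertex on it has a smaller value of \<open>g_tilde\<close>. The graph is
  finite, so the strictly decreasing runs of the algorithm terminate.
\<close>

section \<open>Case analysis over three players\<close>

lemma UNIV_3_eq:
  fixes i l m :: 3
  assumes "i \<noteq> l" "i \<noteq> m" "l \<noteq> m"
  shows "UNIV = {i, l, m}"
  by (rule sym, rule card_subset_eq) (use assms in auto)

lemma Compl_singleton_3:
  fixes i l m :: 3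
  assumes "i \<noteq> l" "i \<noteq> m" "l \<noteq> m"
  shows "- {m} = {i, l}"
  using UNIV_3_eq[OF assms] assms by auto

lemma all_3_iff:
  fixes i l m :: 3
  assumes "i \<noteq> l" "i \<noteq> m" "l \<noteq> m"
  shows "(\<forall>x. P x) \<longleftrightarrow> P i \<and> P l \<and> P m"
  using UNIV_3_eq[OF assms] by (metis UNIV_I empty_iff insert_iff)

lemma set_3_eq_iff:
  fixes i l m :: 3
  assumes "i \<noteq> l" "i \<noteq> m" "l \<noteq> m"
  shows "A = B \<longleftrightarrow> (i \<in> A \<longleftrightarrow> i \<in> B) \<and> (l \<in> A \<longleftrightarrow> l \<in> B) \<and> (m \<in> A \<longleftrightarrow> m \<in> B)"
  unfolding set_eq_iff by (rule all_3_iff[OF assms])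

text \<open>Applied to sets of active players, this separates the plotted point of a good, where all
  three tie, from the other points of its segment towards corner \<open>m\<close>.\<close>

lemma Compl_singleton_subset_iff: "- {m} \<subseteq> A \<longleftrightarrow> A = UNIV \<or> A = - {m}"
  by (cases "m \<in> A") auto

lemma sum_3_eq:
  fixes i l m :: 3
  assumes "i \<noteq> l" "i \<noteq> m" "l \<noteq> m"
  shows "sum f UNIV = f i + f l + (f m :: real)"
  unfolding UNIV_3_eq[OF assms] using assms by simp

lemma obtain_other_two:
  fixes m :: 3
  obtains i l where "i \<noteq> l" "i \<noteq> m" "l \<noteq> m"
proof -
  have "card (- {m}) = 2" by (simp add: Compl_eq_Diff_UNIV card_Diff_subset)
  then show ?thesis using that by (auto simp: card_2_iff)
qed

lemma obtain_third:
  fixes i l :: 3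
  assumes "i \<noteq> l"
  obtains m where "i \<noteq> m" "l \<noteq> m"
proof -
  have "card (- {i, l}) = 1" using assms by (simp add: Compl_eq_Diff_UNIV card_Diff_subset)
  then show ?thesis using that by (auto simp: card_1_singleton_iff)
qed

section \<open>Reciprocal coordinates and normalization\<close>

text \<open>Passes between points \<open>\<beta>\<close> of the simplex and weights
  \<open>\<gamma>\<close>. It is \<open>RD\<close> without the normalization; positive factors are
  handled by homogeneity instead.\<close>

definition recip :: "real^3 \<Rightarrow> real^3" where
  "recip x = (\<chi> i. 1 / x $ i)"

lemma recip_nth [simp]: "recip x $ i = 1 / x $ i"
  by (simp add: recip_def)

lemma normalize_vec_nth: "normalize_vec x $ i = x $ i / sum (($) x) UNIV"
  by (simp add: normalize_vec_def divide_inverse mult.commute)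

lemma sum_nth_pos: "(\<And>i. (x::real^3) $ i > 0) \<Longrightarrow> sum (($) x) UNIV > 0"
  by (rule sum_pos) auto

lemma normalize_vec_pos: "(\<And>i. x $ i > 0) \<Longrightarrow> normalize_vec x $ i > 0"
  by (simp add: normalize_vec_nth sum_nth_pos)

lemma normalize_vec_in_RNS: "(\<And>i. x $ i > 0) \<Longrightarrow> normalize_vec x \<in> RNS"
  using sum_nth_pos[of x] normalize_vec_pos[of x]
  by (auto simp: RNS_def normalize_vec_nth less_imp_le simp flip: sum_divide_distrib)

section \<open>Active players and sublinearity of \<open>g\<close>\<close>

definition top_value :: "real^'m^3 \<Rightarrow> real^3 \<Rightarrow> 'm \<Rightarrow> real" where
  "top_value a \<gamma> j = (MAX i. \<gamma> $ i * a $ i $ j)"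

text \<open>These are the players who can receive shares of good \<open>j\<close> in an allocation
  maximizing the \<open>\<gamma>\<close>-weighted sum of values.\<close>

definition active :: "real^'m^3 \<Rightarrow> real^3 \<Rightarrow> 'm \<Rightarrow> 3 set" where
  "active a \<gamma> j = {i. \<gamma> $ i * a $ i $ j = top_value a \<gamma> j}"

lemma top_value_ge: "\<gamma> $ i * a $ i $ j \<le> top_value a \<gamma> j"
  unfolding top_value_def by (rule Max_ge) auto

lemma active_iff: "i \<in> active a \<gamma> j \<longleftrightarrow> (\<forall>l. \<gamma> $ l * a $ l $ j \<le> \<gamma> $ i * a $ i $ j)"
proof
  assume "\<forall>l. \<gamma> $ l * a $ l $ j \<le> \<gamma> $ i * a $ i $ j"
  then have "top_value a \<gamma> j \<le> \<gamma> $ i * a $ i $ j"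
    unfolding top_value_def by (subst Max_le_iff) auto
  then show "i \<in> active a \<gamma> j"
    using top_value_ge[of \<gamma> i a j] by (simp add: active_def)
qed (use top_value_ge[of \<gamma> _ a j] in \<open>auto simp: active_def\<close>)

lemma active_top: "i \<in> active a \<gamma> j \<Longrightarrow> \<gamma> $ i * a $ i $ j = top_value a \<gamma> j"
  by (simp add: active_def)

lemma not_active_less: "i \<notin> active a \<gamma> j \<Longrightarrow> \<gamma> $ i * a $ i $ j < top_value a \<gamma> j"
  using top_value_ge[of \<gamma> i a j] by (simp add: active_def)

lemma active_nonempty: "active a \<gamma> j \<noteq> {}"
proof -
  have "top_value a \<gamma> j \<in> range (\<lambda>i. \<gamma> $ i * a $ i $ j)"
    unfolding top_value_def by (rule Max_in) auto
  then show ?thesis by (auto simp: active_def)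
qed

lemma top_value_unfold:
  assumes "i \<noteq> l" "i \<noteq> m" "l \<noteq> m"
  shows "top_value a \<gamma> j = max (max (\<gamma> $ i * a $ i $ j) (\<gamma> $ l * a $ l $ j)) (\<gamma> $ m * a $ m $ j)"
  unfolding top_value_def UNIV_3_eq[OF assms] by (simp add: max.assoc)

lemma active_scale: "c > 0 \<Longrightarrow> active a (c *\<^sub>R \<gamma>) j = active a \<gamma> j"
  by (auto simp: active_iff mult.assoc)

lemma g_eq_sum_top: "g a \<gamma> = (\<Sum>j\<in>UNIV. top_value a \<gamma> j)"
  by (simp add: g_eq_sum_Max top_value_def)

lemma g_ge: "y \<in> IPS a \<Longrightarrow> \<gamma> \<bullet> y \<le> g a \<gamma>"
  unfolding g_eq_sum_Max by (rule inner_IPS_le)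

lemma g_scale: "c > 0 \<Longrightarrow> g a (c *\<^sub>R \<gamma>) = c * g a \<gamma>"
proof -
  assume c: "c > 0"
  have "top_value a (c *\<^sub>R \<gamma>) j = c * top_value a \<gamma> j" for j
  proof -
    obtain i where i: "i \<in> active a \<gamma> j" using active_nonempty by blast
    show ?thesis
      using active_top[OF i] active_top[of i a "c *\<^sub>R \<gamma>" j] i c by (simp add: active_scale mult.assoc)
  qed
  then show ?thesis by (simp add: g_eq_sum_top sum_distrib_left)
qed

text \<open>\<open>g a\<close> is the support function of \<open>IPS a\<close>: a maximizer for the
  sum is a feasible point for each summand.\<close>

lemma g_add_le: "g a (\<gamma> + \<delta>) \<le> g a \<gamma> + g a \<delta>"
proof -
  obtain y where "y \<in> IPS a" "(\<gamma> + \<delta>) \<bullet> y = g a (\<gamma> + \<delta>)" using g_attained by blast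
  then show ?thesis using g_ge[of y a \<gamma>] g_ge[of y a \<delta>] by (simp add: inner_add_left)
qed

lemma recip_normalize:
  assumes "\<And>i. x $ i > 0"
  shows "recip (normalize_vec x) = sum (($) x) UNIV *\<^sub>R recip x"
  by (simp add: vec_eq_iff normalize_vec_nth)

text \<open>Zero entries are covered as well, since division by zero gives zero.\<close>

lemma recip_recip [simp]: "recip (recip x) = x"
  by (simp add: vec_eq_iff)

lemma RD_eq: "RD v = normalize_vec (recip v)"
  by (simp add: RD_def recip_def)

lemma g_tilde_eq:
  assumes "\<And>i. v $ i > 0"
  shows "g_tilde a v = g a (recip v) / sum (($) (recip v)) UNIV"
proof -
  have "sum (($) (recip v)) UNIV > 0" by (rule sum_nth_pos) (simp add: assms)
  then show ?thesis
    unfolding g_tilde_def RD_eq normalize_vec_def by (subst g_scale) (auto simp: field_simps)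
qed

section \<open>Geometry of \<open>IPS\<close> and a criterion for optimality\<close>

lemma IPS_convex: "convex (IPS a)"
proof (rule convexI)
  fix x y :: "real^3" and u w :: real
  assume "x \<in> IPS a" "y \<in> IPS a" and uw: "0 \<le> u" "0 \<le> w" "u + w = 1"
  then obtain X Y where X: "allocation X" "x = valuation a X" and Y: "allocation Y" "y = valuation a Y"
    by (auto simp: IPS_def)
  have "allocation (u *\<^sub>R X + w *\<^sub>R Y)"
    using X Y uw by (auto simp: allocation_def sum.distrib simp flip: sum_distrib_left)
  moreover have "valuation a (u *\<^sub>R X + w *\<^sub>R Y) = u *\<^sub>R x + w *\<^sub>R y"
    by (simp add: X Y valuation_def vec_eq_iff sum_distrib_left distrib_left sum.distrib mult.left_commute)
  ultimately show "u *\<^sub>R x + w *\<^sub>R y \<in> IPS a"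
    unfolding IPS_def by (metis (mono_tags, lifting) mem_Collect_eq)
qed

lemma allocation_le_1: "allocation X \<Longrightarrow> X $ i $ j \<le> 1"
  unfolding allocation_def
  by (metis finite iso_tuple_UNIV_I member_le_sum)

lemma IPS_compact: "compact (IPS (a :: real^'m^3))"
proof -
  have "bounded {X :: real^'m^3. allocation X}"
  proof -
    have "norm X \<le> (\<Sum>i\<in>(UNIV :: 3 set). \<Sum>j\<in>(UNIV :: 'm set). 1)" if "allocation X" for X :: "real^'m^3"
    proof -
      have "norm X \<le> (\<Sum>i\<in>UNIV. norm (X $ i))" by (simp add: norm_vec_def L2_set_le_sum)
      also have "\<dots> \<le> (\<Sum>i\<in>(UNIV :: 3 set). \<Sum>j\<in>(UNIV :: 'm set). 1)"
      proof (rule sum_mono)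
        fix i
        have "norm (X $ i) \<le> (\<Sum>j\<in>UNIV. \<bar>X $ i $ j\<bar>)" by (rule norm_le_l1_cart)
        also have "\<dots> \<le> (\<Sum>j\<in>(UNIV :: 'm set). 1)"
          using that
          by (intro sum_mono)
            (auto simp: allocation_def abs_le_iff intro: allocation_le_1[OF that] order_trans[of _ 0])
        finally show "norm (X $ i) \<le> (\<Sum>j\<in>(UNIV :: 'm set). 1)" .
      qed
      finally show ?thesis .
    qed
    then show ?thesis unfolding bounded_iff by blast
  qed
  moreover have "closed {X :: real^'m^3. allocation X}"
    unfolding allocation_def
    by (intro closed_Collect_conj closed_Collect_all closed_Collect_le closed_Collect_eq continuous_intros)
  ultimately have "compact {X :: real^'m^3. allocation X}" by (simp add: compact_eq_bounded_closed)
  moreover have "continuous_on {X :: real^'m^3. allocation X} (valuation a)"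
    unfolding valuation_def by (intro continuous_intros)
  ultimately have "compact (valuation a ` {X. allocation X})" by (rule compact_continuous_image[rotated])
  moreover have "valuation a ` {X. allocation X} = IPS a" by (auto simp: IPS_def)
  ultimately show ?thesis by simp
qed

lemma optimal_vertexI:
  assumes v: "v \<in> graph_verts a" and pos: "\<And>i. v $ i > 0"
    and min: "\<And>\<delta>. (\<And>i. \<delta> $ i > 0) \<Longrightarrow> g_tilde a v * sum (($) \<delta>) UNIV \<le> g a \<delta>"
    and nonneg: "0 \<le> g_tilde a v"
  shows "optimal_vertex a v"
proof -
  define t where "t = g_tilde a v"
  define p :: "real^3" where "p = t *\<^sub>R (\<chi> i. 1)"
  define \<gamma> where "\<gamma> = recip v"
  have \<gamma>: "\<gamma> $ i > 0" for i using pos by (simp add: \<gamma>_def)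
  have sum_pos: "sum (($) \<gamma>) UNIV > 0" by (rule sum_nth_pos) (rule \<gamma>)
  have g\<gamma>: "g a \<gamma> = t * sum (($) \<gamma>) UNIV"
    using sum_pos by (simp add: t_def g_tilde_eq[OF pos] \<gamma>_def)
  have inner_p: "c \<bullet> p = t * sum (($) c) UNIV" for c
    by (simp add: p_def inner_vec_def sum_distrib_left mult.commute)
  \<comment> \<open>This is the main point: the entries of \<open>RD v\<close> sum to 1, so
    \<open>p\<close> lies on the supporting hyperplane anyway.\<close>
  have "p \<in> IPS a"
  proof (rule ccontr)
    assume "p \<notin> IPS a"
    then obtain c b where c: "c \<bullet> p < b" "\<And>y. y \<in> IPS a \<Longrightarrow> c \<bullet> y > b"
      using separating_hyperplane_closed_point[OF IPS_convex compact_imp_closed[OF IPS_compact]] by blast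
    have neg: "g a (- c) < (- c) \<bullet> p"
    proof -
      obtain y where "y \<in> IPS a" "(- c) \<bullet> y = g a (- c)" using g_attained by blast
      then show ?thesis using c by (metis inner_minus_left less_trans neg_less_iff_less)
    qed
    \<comment> \<open>The direction \<open>- c\<close> may have entries of any sign, while
      \<open>min\<close> speaks of positive vectors only. A small step from \<open>\<gamma>\<close>
      in this direction stays positive, and sublinearity carries the strict inequality over to
      it.\<close>
    have "\<forall>\<^sub>F \<epsilon> in at_right 0. \<gamma> $ i + \<epsilon> * (- c $ i) > 0" for i
    proof (rule order_tendstoD(1))
      show "((\<lambda>\<epsilon>. \<gamma> $ i + \<epsilon> * (- c $ i)) \<longlongrightarrow> \<gamma> $ i + 0 * (- c $ i)) (at_right 0)"
        by (intro tendsto_intros)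
    qed (simp add: \<gamma>)
    then have "\<forall>\<^sub>F \<epsilon> in at_right 0. \<forall>i. \<gamma> $ i + \<epsilon> * (- c $ i) > 0"
      by (simp add: eventually_all_finite)
    then have "\<forall>\<^sub>F \<epsilon> in at_right (0::real). \<epsilon> > 0 \<and> (\<forall>i. \<gamma> $ i + \<epsilon> * (- c $ i) > 0)"
      by (simp add: eventually_at_right_less eventually_conj)
    then obtain \<epsilon> :: real where \<epsilon>: "\<epsilon> > 0" "\<And>i. \<gamma> $ i + \<epsilon> * (- c $ i) > 0"
      using eventually_happens' trivial_limit_at_right_real by blast
    define \<delta> where "\<delta> = \<gamma> + \<epsilon> *\<^sub>R (- c)"
    have "t * sum (($) \<delta>) UNIV \<le> g a \<delta>"
      unfolding t_def by (rule min) (use \<epsilon> in \<open>simp add: \<delta>_def\<close>)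
    also have "\<dots> \<le> g a \<gamma> + \<epsilon> * g a (- c)"
      using g_add_le[of a \<gamma> "\<epsilon> *\<^sub>R (- c)"] \<epsilon> g_scale[of \<epsilon> a "- c"] by (simp add: \<delta>_def)
    also have "\<dots> < \<gamma> \<bullet> p + \<epsilon> * ((- c) \<bullet> p)"
      using neg \<epsilon> by (simp add: g\<gamma> inner_p)
    also have "\<dots> = \<delta> \<bullet> p" by (simp add: \<delta>_def inner_add_left inner_diff_left)
    finally show False by (simp add: inner_p)
  qed
  moreover have "p \<in> supp_hyperplane a (RD v)"
  proof -
    have "sum (($) (RD v)) UNIV = 1"
      using normalize_vec_in_RNS[of \<gamma>] \<gamma> by (simp add: RD_eq \<gamma>_def RNS_def)
    then show ?thesis
      by (simp add: supp_hyperplane_def inner_p t_def g_tilde_def)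
  qed
  moreover have "p \<in> egalitarian_ray"
    using nonneg by (auto simp: egalitarian_ray_def p_def t_def)
  ultimately show ?thesis using v by (auto simp: optimal_vertex_def pareto_face_def)
qed

lemma graph_verts_subset_RNS: "v \<in> graph_verts a \<Longrightarrow> v \<in> RNS"
  by (simp add: graph_verts_def)

section \<open>Slopes of \<open>g\<close> in single coordinates\<close>

text \<open>Up to the factor \<open>\<gamma>\<^sub>m\<close>, the one-sided derivatives of \<open>\<lambda>\<delta>. g a \<delta> - t * (\<Sum>i. \<delta>\<^sub>i)\<close> at \<open>\<gamma>\<close>
  when coordinate \<open>m\<close> increases, respectively decreases.\<close>

definition slope_up :: "real^'m^3 \<Rightarrow> real \<Rightarrow> real^3 \<Rightarrow> 3 \<Rightarrow> real" where
  "slope_up a t \<gamma> m = (\<Sum>j\<in>UNIV. if m \<in> active a \<gamma> j then top_value a \<gamma> j else 0) - t * \<gamma> $ m"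

definition slope_down :: "real^'m^3 \<Rightarrow> real \<Rightarrow> real^3 \<Rightarrow> 3 \<Rightarrow> real" where
  "slope_down a t \<gamma> m = t * \<gamma> $ m - (\<Sum>j\<in>UNIV. if active a \<gamma> j = {m} then top_value a \<gamma> j else 0)"

lemma obtain_sorted_3:
  fixes x :: "3 \<Rightarrow> real"
  obtains p q r where "p \<noteq> q" "p \<noteq> r" "q \<noteq> r" "x r \<le> x q" "x q \<le> x p"
proof -
  obtain i l where d: "i \<noteq> l" "i \<noteq> (1::3)" "l \<noteq> 1" by (rule obtain_other_two)
  then show ?thesis
    using that[of i l 1] that[of i 1 l] that[of l i 1] that[of l 1 i] that[of 1 i l] that[of 1 l i]
      linorder_linear[of "x i" "x l"] linorder_linear[of "x i" "x 1"] linorder_linear[of "x l" "x 1"]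
    by blast
qed

text \<open>The relative increments \<open>\<delta>\<^sub>i / \<gamma>\<^sub>i\<close>, sorted, are up to a constant a nonnegative combination of
  \<open>e\<^sub>p\<close> and \<open>-e\<^sub>r\<close> for the largest entry \<open>p\<close> and the smallest entry \<open>r\<close>. Maxima over subsets of
  the players are additive on such comonotone combinations.\<close>

lemma exists_improving_slope:
  assumes pos: "\<And>i. \<gamma> $ i > 0" and t: "t * sum (($) \<gamma>) UNIV = g a \<gamma>"
    and less: "g a \<delta> < t * sum (($) \<delta>) UNIV"
  shows "\<exists>m. slope_up a t \<gamma> m < 0 \<or> slope_down a t \<gamma> m < 0"
proof -
  define x where "x i = \<delta> $ i / \<gamma> $ i" for i
  obtain p q r where d: "p \<noteq> q" "p \<noteq> r" "q \<noteq> r" and le: "x r \<le> x q" "x q \<le> x p"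
    by (rule obtain_sorted_3)
  have \<delta>: "\<delta> $ i = x i * \<gamma> $ i" for i using pos[of i] by (simp add: x_def)
  define T where "T = top_value a \<gamma>"
  \<comment> \<open>The left side equals \<open>x i * T j\<close> for one active player
    \<open>i\<close>: it is \<open>p\<close> if active, otherwise \<open>q\<close> if active,
    otherwise \<open>r\<close>.\<close>
  have bound: "x q * T j + (x p - x q) * (if p \<in> active a \<gamma> j then T j else 0)
      - (x q - x r) * (if active a \<gamma> j = {r} then T j else 0) \<le> top_value a \<delta> j" for j
  proof -
    have act: "x i * T j \<le> top_value a \<delta> j" if "i \<in> active a \<gamma> j" for i
      using active_top[OF that] top_value_ge[of \<delta> i a j] by (simp add: \<delta> T_def mult.assoc)
    consider "p \<in> active a \<gamma> j" | "p \<notin> active a \<gamma> j" "q \<in> active a \<gamma> j" | "active a \<gamma> j = {r}"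
      using active_nonempty[of a \<gamma> j] d by (auto simp: set_3_eq_iff[OF d])
    then show ?thesis
    proof cases
      case 1
      then show ?thesis using act[of p] d by (auto simp: algebra_simps)
    next
      case 2
      then show ?thesis using act[of q] d by auto
    next
      case 3
      then show ?thesis using act[of r] d by (auto simp: algebra_simps)
    qed
  qed
  define P where "P = (\<Sum>j\<in>UNIV. if p \<in> active a \<gamma> j then T j else 0)"
  define R where "R = (\<Sum>j\<in>UNIV. if active a \<gamma> j = {r} then T j else 0)"
  have "x q * g a \<gamma> + (x p - x q) * P - (x q - x r) * R \<le> g a \<delta>"
    unfolding P_def R_def g_eq_sum_top sum_distrib_left T_def[symmetric]
    unfolding sum.distrib[symmetric] sum_subtractf[symmetric]
    by (rule sum_mono) (rule bound)
  also have "g a \<delta> < t * (x p * \<gamma> $ p + x q * \<gamma> $ q + x r * \<gamma> $ r)"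
    using less by (simp add: sum_3_eq[OF d] \<delta>)
  \<comment> \<open>After cancelling the common part \<open>x q * g a \<gamma>\<close>, what remains
    is a combination of the two slopes with nonnegative weights.\<close>
  finally have "(x p - x q) * (P - t * \<gamma> $ p) + (x q - x r) * (t * \<gamma> $ r - R) < 0"
    using t[symmetric] by (simp add: sum_3_eq[OF d] algebra_simps)
  moreover have "(x p - x q) * (P - t * \<gamma> $ p) + (x q - x r) * (t * \<gamma> $ r - R) \<ge> 0"
    if "P - t * \<gamma> $ p \<ge> 0" "t * \<gamma> $ r - R \<ge> 0"
    using that le by simp
  ultimately have "P - t * \<gamma> $ p < 0 \<or> t * \<gamma> $ r - R < 0" by linarith
  then show ?thesis unfolding slope_up_def slope_down_def P_def R_def T_def by blast
qed

text \<open>By homogeneity, raising coordinate \<open>p\<close> amounts to lowering \<open>q\<close>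
  and \<open>r\<close> in equal proportion. The effects of lowering them add up unless some good has
  exactly these two players active, since then only the joint move lowers its maximum.\<close>

lemma slope_up_split:
  assumes d: "p \<noteq> q" "p \<noteq> r" "q \<noteq> r" and t: "t * sum (($) \<gamma>) UNIV = g a \<gamma>"
    and n: "\<And>j. active a \<gamma> j \<noteq> {q, r}"
  shows "slope_up a t \<gamma> p = slope_down a t \<gamma> q + slope_down a t \<gamma> r"
proof -
  have "top_value a \<gamma> j = (if p \<in> active a \<gamma> j then top_value a \<gamma> j else 0)
     + (if active a \<gamma> j = {q} then top_value a \<gamma> j else 0)
     + (if active a \<gamma> j = {r} then top_value a \<gamma> j else 0)" for j
  proof -
    have "p \<in> active a \<gamma> j \<or> active a \<gamma> j = {q} \<or> active a \<gamma> j = {r}"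
      using active_nonempty[of a \<gamma> j] n[of j] d by (auto simp: set_3_eq_iff[OF d])
    then show ?thesis using d by auto
  qed
  then have "g a \<gamma> = (\<Sum>j\<in>UNIV. (if p \<in> active a \<gamma> j then top_value a \<gamma> j else 0)
     + (if active a \<gamma> j = {q} then top_value a \<gamma> j else 0)
     + (if active a \<gamma> j = {r} then top_value a \<gamma> j else 0))"
    unfolding g_eq_sum_top by (rule sum.cong[OF refl])
  then show ?thesis
    using t by (simp add: slope_up_def slope_down_def sum.distrib sum_3_eq[OF d] algebra_simps)
qed

text \<open>Dually, lowering \<open>p\<close> amounts to raising \<open>q\<close> and
  \<open>r\<close> in equal proportion. These effects add up when no good has both active, as such a
  good would be counted twice.\<close>

lemma slope_down_split:
  assumes d: "p \<noteq> q" "p \<noteq> r" "q \<noteq> r" and t: "t * sum (($) \<gamma>) UNIV = g a \<gamma>"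
    and n: "\<And>j. \<not> {q, r} \<subseteq> active a \<gamma> j"
  shows "slope_down a t \<gamma> p = slope_up a t \<gamma> q + slope_up a t \<gamma> r"
proof -
  have "top_value a \<gamma> j = (if active a \<gamma> j = {p} then top_value a \<gamma> j else 0)
     + (if q \<in> active a \<gamma> j then top_value a \<gamma> j else 0)
     + (if r \<in> active a \<gamma> j then top_value a \<gamma> j else 0)" for j
  proof -
    have "active a \<gamma> j = {p} \<or> q \<in> active a \<gamma> j \<or> r \<in> active a \<gamma> j"
      using active_nonempty[of a \<gamma> j] d by (auto simp: set_3_eq_iff[OF d])
    then show ?thesis using d n[of j] by auto
  qed
  then have "g a \<gamma> = (\<Sum>j\<in>UNIV. (if active a \<gamma> j = {p} then top_value a \<gamma> j else 0)
     + (if q \<in> active a \<gamma> j then top_value a \<gamma> j else 0)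
     + (if r \<in> active a \<gamma> j then top_value a \<gamma> j else 0))"
    unfolding g_eq_sum_top by (rule sum.cong[OF refl])
  then show ?thesis
    using t by (simp add: slope_up_def slope_down_def sum.distrib sum_3_eq[OF d] algebra_simps)
qed

section \<open>Moving one coordinate and its breakpoints\<close>

text \<open>After taking reciprocals and normalizing, positive values of \<open>s\<close> trace
  points on a line through corner \<open>m\<close>, because the ratio of the other two coordinates
  is kept.\<close>

definition set_coord :: "real^3 \<Rightarrow> 3 \<Rightarrow> real \<Rightarrow> real^3" where
  "set_coord \<gamma> m s = (\<chi> x. if x = m then s else \<gamma> $ x)"

lemma set_coord_nth: "set_coord \<gamma> m s $ x = (if x = m then s else \<gamma> $ x)"
  by (simp add: set_coord_def)

lemma sum_set_coord: "sum (($) (set_coord \<gamma> m s)) UNIV = sum (($) \<gamma>) UNIV + (s - \<gamma> $ m)"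
proof -
  obtain i l where d: "i \<noteq> l" "i \<noteq> m" "l \<noteq> m" by (rule obtain_other_two)
  then show ?thesis by (simp add: sum_3_eq[OF d] set_coord_nth)
qed

definition others_value :: "real^'m^3 \<Rightarrow> real^3 \<Rightarrow> 3 \<Rightarrow> 'm \<Rightarrow> real" where
  "others_value a \<gamma> m j = Max ((\<lambda>x. \<gamma> $ x * a $ x $ j) ` (- {m}))"

text \<open>The value of coordinate \<open>m\<close>, the others being fixed, at which player \<open>m\<close> joins the players
  attaining the maximum for good \<open>j\<close>.\<close>

definition break_at :: "real^'m^3 \<Rightarrow> real^3 \<Rightarrow> 3 \<Rightarrow> 'm \<Rightarrow> real" where
  "break_at a \<gamma> m j = others_value a \<gamma> m j / a $ m $ j"

lemma others_value_eq:
  assumes d: "i \<noteq> l" "i \<noteq> m" "l \<noteq> m"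
  shows "others_value a \<gamma> m j = max (\<gamma> $ i * a $ i $ j) (\<gamma> $ l * a $ l $ j)"
  by (simp add: others_value_def Compl_singleton_3[OF d])

lemma others_value_set_coord: "others_value a (set_coord \<gamma> m s) m j = others_value a \<gamma> m j"
proof -
  obtain i l where d: "i \<noteq> l" "i \<noteq> m" "l \<noteq> m" by (rule obtain_other_two)
  then show ?thesis by (simp add: others_value_eq[OF d] set_coord_nth)
qed

lemma break_at_set_coord: "break_at a (set_coord \<gamma> m s) m j = break_at a \<gamma> m j"
  by (simp add: break_at_def others_value_set_coord)

lemma break_at_scale:
  assumes "c > 0"
  shows "break_at a (c *\<^sub>R \<gamma>) m j = c * break_at a \<gamma> m j"
proof -
  obtain i l where d: "i \<noteq> l" "i \<noteq> m" "l \<noteq> m" by (rule obtain_other_two)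
  show ?thesis using assms
    by (simp add: break_at_def others_value_eq[OF d] mult.assoc max_mult_distrib_left)
qed

lemma top_value_others: "top_value a \<gamma> j = max (others_value a \<gamma> m j) (\<gamma> $ m * a $ m $ j)"
proof -
  obtain i l where d: "i \<noteq> l" "i \<noteq> m" "l \<noteq> m" by (rule obtain_other_two)
  then show ?thesis by (simp add: others_value_eq[OF d] top_value_unfold[OF d])
qed

lemma set_coord_pos: "(\<And>i. \<gamma> $ i > 0) \<Longrightarrow> s > 0 \<Longrightarrow> set_coord \<gamma> m s $ i > 0"
  by (simp add: set_coord_nth)

text \<open>Normalizing in the simplex only rescales the weights, so active sets and quotients of
  homogeneous functions can be computed at the unnormalized \<open>\<gamma>\<close>.\<close>

lemma recip_normalize_recip:
  assumes "\<And>i. \<gamma> $ i > 0"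
  shows "\<exists>c>0. recip (normalize_vec (recip \<gamma>)) = c *\<^sub>R \<gamma>"
  using recip_normalize[of "recip \<gamma>"] sum_nth_pos[of "recip \<gamma>"] assms by auto

lemma active_normalize_recip:
  assumes "\<And>i. \<gamma> $ i > 0"
  shows "active a (recip (normalize_vec (recip \<gamma>))) j = active a \<gamma> j"
  using recip_normalize_recip[OF assms] active_scale by metis

text \<open>A convex combination of points of the simplex becomes a weighted harmonic mean in
  reciprocal coordinates; betweenness survives this change.\<close>

lemma harmonic_mean_between:
  assumes "A > 0" "B > 0" "0 < x" "x < (y :: real)"
  shows "x < (A + B) / (A / x + B / y)" "(A + B) / (A / x + B / y) < y"
proof -
  have p: "A / x + B / y > 0" using assms by (simp add: add_pos_pos)
  have "x * (A / x + B / y) < A + B" "A + B < y * (A / x + B / y)"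
    using assms by (simp_all add: field_simps)
  then show "x < (A + B) / (A / x + B / y)" "(A + B) / (A / x + B / y) < y"
    using p by (simp_all add: field_simps)
qed

lemma g_tilde_normalize_recip:
  assumes pos: "\<And>i. \<gamma> $ i > 0"
  shows "g_tilde a (normalize_vec (recip \<gamma>)) = g a \<gamma> / sum (($) \<gamma>) UNIV"
proof -
  obtain c where c: "c > 0" "recip (normalize_vec (recip \<gamma>)) = c *\<^sub>R \<gamma>"
    using recip_normalize_recip[OF pos] by auto
  have "normalize_vec (recip \<gamma>) $ i > 0" for i using pos by (simp add: normalize_vec_pos)
  then show ?thesis using c by (simp add: g_tilde_eq g_scale flip: sum_distrib_left)
qed

lemma alg_step_decreases: "alg_step a v w \<Longrightarrow> g_tilde a w < g_tilde a v"
  by (force simp: alg_step_def alg_stops_def)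

lemma alg_step_graph_verts: "alg_step a v w \<Longrightarrow> w \<in> graph_verts a"
  by (simp add: alg_step_def graph_adj_def)

section \<open>Supporting segments and graph vertices for positive values\<close>

context
  fixes a :: "real^'m^3"
  assumes MAC: "\<And>i j. a $ i $ j > 0"
begin

lemma good_point_eq: "good_point a j $ i = a $ i $ j / (\<Sum>l\<in>UNIV. a $ l $ j)"
  by (simp add: good_point_def normalize_vec_nth column_def)

lemma sum_good_pos: "(\<Sum>l\<in>(UNIV :: 3 set). a $ l $ j) > 0"
  by (rule sum_pos) (auto simp: MAC)

lemma good_point_pos: "good_point a j $ i > 0"
  by (simp add: good_point_eq sum_good_pos MAC)

lemma good_point_in_RNS: "good_point a j \<in> RNS"
  unfolding good_point_def by (rule normalize_vec_in_RNS) (simp add: column_def MAC)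

text \<open>Adding weight at corner \<open>m\<close> keeps the other two coordinates proportional to
  the values of good \<open>j\<close> and makes coordinate \<open>m\<close> at least proportional.
  In reciprocals, the other two players tie and \<open>m\<close> does not exceed them.\<close>

lemma supp_segment_iff:
  assumes "\<beta> \<in> RNS" and pos: "\<And>i. \<beta> $ i > 0"
  shows "\<beta> \<in> supp_segment a j m \<longleftrightarrow> - {m} \<subseteq> active a (recip \<beta>) j"
proof -
  obtain i l where d: "i \<noteq> l" "i \<noteq> m" "l \<noteq> m" by (rule obtain_other_two)
  define S where "S = (\<Sum>l\<in>UNIV. a $ l $ j)"
  have S: "S > 0" "S = a $ i $ j + a $ l $ j + a $ m $ j"
    unfolding S_def using sum_good_pos[of j] by (simp_all add: sum_3_eq[OF d])
  have sum1: "\<beta> $ i + \<beta> $ l + \<beta> $ m = 1"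
    using assms by (simp add: RNS_def sum_3_eq[OF d])
  have act: "- {m} \<subseteq> active a (recip \<beta>) j \<longleftrightarrow>
      a $ i $ j / \<beta> $ i = a $ l $ j / \<beta> $ l \<and> a $ m $ j / \<beta> $ m \<le> a $ i $ j / \<beta> $ i"
    unfolding Compl_singleton_3[OF d] using d by (auto simp: active_iff all_3_iff[OF d])
  have seg: "\<beta> \<in> supp_segment a j m \<longleftrightarrow> (\<exists>u. 0 \<le> u \<and> u \<le> 1 \<and>
      \<beta> $ i = (1 - u) * (a $ i $ j / S) \<and> \<beta> $ l = (1 - u) * (a $ l $ j / S) \<and>
      \<beta> $ m = (1 - u) * (a $ m $ j / S) + u)"
    using d unfolding supp_segment_def in_segment vec_eq_iff
    by (auto simp: good_point_eq axis_def S_def all_3_iff[OF d])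
  show ?thesis unfolding seg act
  proof safe
    fix u assume u: "0 \<le> u" "u \<le> 1" and e: "\<beta> $ i = (1 - u) * (a $ i $ j / S)"
      "\<beta> $ l = (1 - u) * (a $ l $ j / S)" "\<beta> $ m = (1 - u) * (a $ m $ j / S) + u"
    have "u \<noteq> 1" using e(1) pos[of i] by auto
    then have "1 - u > 0" using u by simp
    then show "a $ i $ j / \<beta> $ i = a $ l $ j / \<beta> $ l"
      unfolding e using MAC[of i j] MAC[of l j] S(1) by simp
    have "(1 - u) * (a $ m $ j / S) \<le> \<beta> $ m" using e u by simp
    then have "a $ m $ j / \<beta> $ m \<le> S / (1 - u)"
      using \<open>1 - u > 0\<close> S(1) pos[of m] by (simp add: field_simps)
    also have "\<dots> = a $ i $ j / \<beta> $ i" unfolding e using MAC[of i j] \<open>1 - u > 0\<close> S(1) by simp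
    finally show "a $ m $ j / \<beta> $ m \<le> a $ i $ j / \<beta> $ i" .
  next
    assume h: "a $ i $ j / \<beta> $ i = a $ l $ j / \<beta> $ l" "a $ m $ j / \<beta> $ m \<le> a $ i $ j / \<beta> $ i"
    \<comment> \<open>\<open>q\<close> is the common ratio of \<open>\<beta>\<close> to the values
      of good \<open>j\<close> for the two players other than \<open>m\<close>. The mass left over
      by \<open>q * S\<close> is the weight \<open>u\<close> of the corner.\<close>
    define q where "q = \<beta> $ i / a $ i $ j"
    have q: "\<beta> $ i = q * a $ i $ j" "\<beta> $ l = q * a $ l $ j" "q * a $ m $ j \<le> \<beta> $ m" "q > 0"
      using h MAC[of i j] MAC[of l j] MAC[of m j] pos[of i] pos[of l] pos[of m]
      by (auto simp: q_def field_simps)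
    have "q * S = \<beta> $ i + \<beta> $ l + q * a $ m $ j" using q(1,2) S(2) by (simp add: algebra_simps)
    then have m: "\<beta> $ m = q * a $ m $ j + (1 - q * S)" using sum1 by simp
    define u where "u = 1 - q * S"
    have "0 \<le> u" "u \<le> 1" "(1 - u) / S = q" using m q S(1) by (auto simp: u_def)
    then show "\<exists>u. 0 \<le> u \<and> u \<le> 1 \<and>
      \<beta> $ i = (1 - u) * (a $ i $ j / S) \<and> \<beta> $ l = (1 - u) * (a $ l $ j / S) \<and>
      \<beta> $ m = (1 - u) * (a $ m $ j / S) + u"
      using q(1,2) m by (intro exI[of _ u]) (auto simp: u_def)
  qed
qed

lemma active_recip_good_point:
  "active a (recip (good_point a j)) k = active a (\<chi> i. 1 / a $ i $ j) k"
proof -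
  have "recip (good_point a j) = (\<Sum>l\<in>UNIV. a $ l $ j) *\<^sub>R (\<chi> i. 1 / a $ i $ j)"
    by (simp add: vec_eq_iff good_point_eq)
  then show ?thesis by (simp only: active_scale[OF sum_good_pos])
qed

text \<open>A full tie makes \<open>\<beta>\<close> proportional to column \<open>j\<close>, and the
  unit sum fixes the scale.\<close>

lemma eq_good_point_iff:
  assumes "\<beta> \<in> RNS" and pos: "\<And>i. \<beta> $ i > 0"
  shows "\<beta> = good_point a j \<longleftrightarrow> active a (recip \<beta>) j = UNIV"
proof
  assume "\<beta> = good_point a j"
  then show "active a (recip \<beta>) j = UNIV"
    using MAC by (auto simp: active_recip_good_point active_iff less_imp_neq[symmetric])
next
  assume U: "active a (recip \<beta>) j = UNIV"
  define t where "t = top_value a (recip \<beta>) j"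
  have a: "a $ i $ j = t * \<beta> $ i" for i
    using active_top[of i a "recip \<beta>" j] U pos[of i] by (simp add: t_def field_simps)
  then have "(\<Sum>l\<in>UNIV. a $ l $ j) = t" 
    using assms by (simp add: RNS_def flip: sum_distrib_left)
  then show "\<beta> = good_point a j"
    using a sum_good_pos[of j] by (simp add: vec_eq_iff good_point_eq)
qed

lemma good_point_in_supp_segment_iff:
  "good_point a j \<in> supp_segment a k m \<longleftrightarrow> - {m} \<subseteq> active a (\<chi> i. 1 / a $ i $ j) k"
  by (simp add: supp_segment_iff good_point_in_RNS good_point_pos active_recip_good_point)

text \<open>Two of three numbers are equal iff their maximum or their minimum is attained twice.\<close>

lemma s_independent_iff: "s_independent a j k \<longleftrightarrow> inj (\<lambda>i. a $ i $ j / a $ i $ k)"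
proof
  assume inj: "inj (\<lambda>i. a $ i $ j / a $ i $ k)"
  have False if h: "- {m} \<subseteq> active a (\<chi> i. 1 / a $ i $ j) k \<or> - {m} \<subseteq> active a (\<chi> i. 1 / a $ i $ k) j" for m
  proof -
    obtain i l where d: "i \<noteq> l" "i \<noteq> m" "l \<noteq> m" by (rule obtain_other_two)
    have "a $ i $ k / a $ i $ j = a $ l $ k / a $ l $ j \<or> a $ i $ j / a $ i $ k = a $ l $ j / a $ l $ k"
      using h d by (auto simp: Compl_singleton_3[OF d] active_def)
    then have "a $ i $ j / a $ i $ k = a $ l $ j / a $ l $ k"
      using MAC[of i j] MAC[of l j] MAC[of i k] MAC[of l k] by (auto simp: field_simps)
    then show False using inj d by (auto dest: injD)
  qed
  then show "s_independent a j k"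
    unfolding s_independent_def good_point_in_supp_segment_iff by blast
next
  assume s: "s_independent a j k"
  show "inj (\<lambda>i. a $ i $ j / a $ i $ k)"
  proof (rule injI, rule ccontr)
    fix i l assume e: "a $ i $ j / a $ i $ k = a $ l $ j / a $ l $ k" and "i \<noteq> l"
    then obtain m where d: "i \<noteq> l" "i \<noteq> m" "l \<noteq> m" by (meson obtain_third)
    have e': "a $ i $ k / a $ i $ j = a $ l $ k / a $ l $ j"
      using e MAC[of i j] MAC[of l j] MAC[of i k] MAC[of l k] by (auto simp: field_simps)
    have "a $ m $ j / a $ m $ k \<le> a $ i $ j / a $ i $ k \<or> a $ m $ k / a $ m $ j \<le> a $ i $ k / a $ i $ j"
      using MAC[of i j] MAC[of m j] MAC[of i k] MAC[of m k] by (auto simp: field_simps)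
    then have "- {m} \<subseteq> active a (\<chi> i. 1 / a $ i $ k) j \<or> - {m} \<subseteq> active a (\<chi> i. 1 / a $ i $ j) k"
      using e e' by (auto simp: Compl_singleton_3[OF d] active_iff all_3_iff[OF d])
    then show False using s unfolding s_independent_def good_point_in_supp_segment_iff by blast
  qed
qed

text \<open>The plotted point is interior to the simplex, so the segment meets the boundary only at
  its corner.\<close>

lemma segment_coord_pos:
  assumes "p \<in> supp_segment a j l" "\<forall>h. p \<noteq> axis h 1"
  shows "p $ i > 0"
proof -
  obtain u where u: "0 \<le> u" "u \<le> 1" "p = (1 - u) *\<^sub>R good_point a j + u *\<^sub>R axis l 1"
    using assms(1) by (auto simp: supp_segment_def in_segment)
  have "u \<noteq> 1" using u(3) assms(2) by auto
  then have "(1 - u) * good_point a j $ i > 0" using u good_point_pos[of j i] by simp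
  moreover have "u * axis l 1 $ i \<ge> 0" using u by (simp add: axis_def)
  ultimately show ?thesis by (simp add: u(3) add_pos_nonneg)
qed

lemma graph_verts_pos: "p \<in> graph_verts a \<Longrightarrow> p $ i > 0"
  by (auto simp: graph_verts_def good_point_pos intro: segment_coord_pos)

text \<open>With \<open>i\<close> the third player, the ratios of the values of \<open>j\<close> and
  \<open>k\<close> are strictly ordered as \<open>m\<close>, \<open>i\<close>, \<open>l\<close>:
  multiplying by \<open>\<gamma>\<close> turns them into quotients of the two maxima, with one
  numerator or denominator too small at \<open>m\<close> or \<open>l\<close>.\<close>

lemma crossing_s_independent:
  assumes "active a \<gamma> j = - {m}" "active a \<gamma> k = - {l}" "m \<noteq> l" "\<And>i. \<gamma> $ i > 0"
  shows "s_independent a j k"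
proof -
  obtain i where d: "m \<noteq> l" "m \<noteq> i" "l \<noteq> i" using assms(3) by (meson obtain_third)
  define s t where "s = top_value a \<gamma> j" and "t = top_value a \<gamma> k"
  have j: "\<gamma> $ i * a $ i $ j = s" "\<gamma> $ l * a $ l $ j = s" "\<gamma> $ m * a $ m $ j < s"
    using d assms by (auto simp: s_def intro: active_top not_active_less)
  have k: "\<gamma> $ i * a $ i $ k = t" "\<gamma> $ m * a $ m $ k = t" "\<gamma> $ l * a $ l $ k < t"
    using d assms by (auto simp: t_def intro: active_top not_active_less)
  have r: "a $ x $ j / a $ x $ k = (\<gamma> $ x * a $ x $ j) / (\<gamma> $ x * a $ x $ k)" for x
    using assms(4)[of x] by simp
  have p: "\<gamma> $ x * a $ x $ y > 0" for x y using assms(4) MAC by simp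
  have "t > 0" "s > 0" using p j(1) k(1) by metis+
  have "a $ m $ j / a $ m $ k < a $ i $ j / a $ i $ k"
    unfolding r j(1) k(1,2) using j(3) \<open>t > 0\<close> by (simp add: divide_strict_right_mono)
  moreover have "a $ i $ j / a $ i $ k < a $ l $ j / a $ l $ k"
    unfolding r j(1,2) k(1) using k(3) p[of l k] \<open>s > 0\<close> by (simp add: divide_strict_left_mono)
  ultimately show ?thesis unfolding s_independent_iff inj_def
    by (simp add: all_3_iff[OF d])
qed

text \<open>Removes s-independence in favour of active sets. It excludes overlapping segments
  towards the same corner, and it is automatic for proper crossings of segments towards different
  corners.\<close>

lemma graph_verts_iff:
  "p \<in> graph_verts a \<longleftrightarrow> p \<in> RNS \<and> (\<forall>i. p $ i > 0) \<and>
    ((\<exists>j. active a (recip p) j = UNIV) \<or>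
     (\<exists>j k m l. m \<noteq> l \<and> active a (recip p) j = - {m} \<and> active a (recip p) k = - {l}))"
proof (cases "p \<in> RNS \<and> (\<forall>i. p $ i > 0)")
  case False
  moreover from False have "p \<notin> graph_verts a"
    using graph_verts_pos[of p] graph_verts_subset_RNS[of p a] by auto
  ultimately show ?thesis by auto
next
  case True
  then have R: "p \<in> RNS" and pos: "\<And>i. p $ i > 0" by auto
  have ax: "p \<noteq> axis h 1" for h
  proof
    assume p: "p = axis h 1"
    obtain i l where "i \<noteq> l" "i \<noteq> h" "l \<noteq> h" by (rule obtain_other_two)
    then show False using pos[of i] by (simp add: p axis_def)
  qed
  have gv: "p \<in> graph_verts a \<longleftrightarrow> (\<exists>j. active a (recip p) j = UNIV) \<or>
     (\<exists>j k m l. s_independent a j k \<and> - {m} \<subseteq> active a (recip p) j \<and> - {l} \<subseteq> active a (recip p) k)"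
    using R ax by (simp add: graph_verts_def eq_good_point_iff[OF R pos] supp_segment_iff[OF R pos])
  have forward: "(\<exists>j. active a (recip p) j = UNIV) \<or>
     (\<exists>j k m l. m \<noteq> l \<and> active a (recip p) j = - {m} \<and> active a (recip p) k = - {l})"
    if s: "s_independent a j k" and m: "- {m} \<subseteq> active a (recip p) j"
      and l: "- {l} \<subseteq> active a (recip p) k"
    for j k m l
  proof (rule ccontr)
    assume n: "\<not> ?thesis"
    have "active a (recip p) j = - {m}" "active a (recip p) k = - {l}" 
      using n m l unfolding Compl_singleton_subset_iff by auto
    \<comment> \<open>With neither a full tie nor two different corners, both goods tie the same two
      players. The ratio of the values of \<open>j\<close> and \<open>k\<close> is then
      \<open>s / t\<close> for both, against injectivity.\<close>
    with n have e: "active a (recip p) j = - {m}" "active a (recip p) k = - {m}" by metis+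
    obtain x y where d: "x \<noteq> y" "x \<noteq> m" "y \<noteq> m" by (rule obtain_other_two)
    define s t where "s = top_value a (recip p) j" and "t = top_value a (recip p) k"
    have st: "a $ x $ j = s * p $ x" "a $ y $ j = s * p $ y" "a $ x $ k = t * p $ x" "a $ y $ k = t * p $ y"
      using d e active_top[of x a "recip p" j] active_top[of y a "recip p" j]
        active_top[of x a "recip p" k] active_top[of y a "recip p" k] pos[of x] pos[of y]
      by (auto simp: s_def t_def field_simps)
    then have "a $ x $ j / a $ x $ k = a $ y $ j / a $ y $ k" using pos[of x] pos[of y] by simp
    then show False using s d unfolding s_independent_iff by (auto dest: injD)
  qed
  have backward: "s_independent a j k \<and> - {m} \<subseteq> active a (recip p) j \<and> - {l} \<subseteq> active a (recip p) k"
    if "m \<noteq> l" "active a (recip p) j = - {m}" "active a (recip p) k = - {l}" for j k m l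
    using that crossing_s_independent[of "recip p"] pos by simp
  show ?thesis
  proof
    assume "p \<in> graph_verts a"
    then show "p \<in> RNS \<and> (\<forall>i. p $ i > 0) \<and> ((\<exists>j. active a (recip p) j = UNIV) \<or>
     (\<exists>j k m l. m \<noteq> l \<and> active a (recip p) j = - {m} \<and> active a (recip p) k = - {l}))"
      using gv True forward by metis
  next
    assume "p \<in> RNS \<and> (\<forall>i. p $ i > 0) \<and> ((\<exists>j. active a (recip p) j = UNIV) \<or>
     (\<exists>j k m l. m \<noteq> l \<and> active a (recip p) j = - {m} \<and> active a (recip p) k = - {l}))"
    then show "p \<in> graph_verts a" using gv backward by metis
  qed
qed

text \<open>At a vertex some player \<open>i\<close> ties with each of the other two, possibly for
  different goods. The ties fix two ratios of coordinates and the unit sum fixes the scale; there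
  are finitely many choices of players and goods.\<close>

lemma finite_graph_verts: "finite (graph_verts a)"
proof -
  \<comment> \<open>Rebuilds a vertex scaled to entry 1 at \<open>i\<close>; the last branch serves
    the third player.\<close>
  define F where "F = (\<lambda>(i :: 3, l :: 3, j :: 'm, k :: 'm). normalize_vec
     (\<chi> x. if x = i then 1 else if x = l then a $ l $ j / a $ i $ j else a $ x $ k / a $ i $ k))"
  have main: "p \<in> range F"
    if R: "p \<in> RNS" and pos: "\<And>x. p $ x > 0" and d: "i \<noteq> l" "i \<noteq> m" "l \<noteq> m"
      and jk: "i \<in> active a (recip p) j" "l \<in> active a (recip p) j"
        "i \<in> active a (recip p) k" "m \<in> active a (recip p) k" for p i l m j k
  proof -
    have "a $ i $ j / p $ i = a $ l $ j / p $ l" "a $ i $ k / p $ i = a $ m $ k / p $ m"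
      using jk by (auto simp: active_def)
    then have e: "a $ l $ j / a $ i $ j = p $ l / p $ i" "a $ m $ k / a $ i $ k = p $ m / p $ i"
      using pos[of i] pos[of l] pos[of m] MAC[of i j] MAC[of i k] by (auto simp: field_simps)
    have "(\<chi> x. if x = i then 1 else if x = l then a $ l $ j / a $ i $ j else a $ x $ k / a $ i $ k)
       = (1 / p $ i) *\<^sub>R p"
      using d e pos[of i] by (auto simp: vec_eq_iff all_3_iff[OF d])
    moreover have "normalize_vec ((1 / p $ i) *\<^sub>R p) = p"
      using R pos[of i] by (simp add: vec_eq_iff normalize_vec_nth RNS_def flip: sum_divide_distrib)
    ultimately have "F (i, l, j, k) = p" by (simp add: F_def)
    then show ?thesis by blast
  qed
  have "graph_verts a \<subseteq> range F"
  proof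
    fix p assume "p \<in> graph_verts a"
    then have R: "p \<in> RNS" and pos: "\<And>x. p $ x > 0" and
      c: "(\<exists>j. active a (recip p) j = UNIV) \<or>
     (\<exists>j k m l. m \<noteq> l \<and> active a (recip p) j = - {m} \<and> active a (recip p) k = - {l})"
      by (auto simp: graph_verts_iff)
    from c show "p \<in> range F"
    proof (elim disjE exE conjE)
      fix j assume "active a (recip p) j = UNIV"
      moreover obtain i l where "i \<noteq> l" "i \<noteq> (1::3)" "l \<noteq> 1" by (rule obtain_other_two)
      ultimately show ?thesis using main[OF R pos, of i l 1 j j] by auto
    next
      fix j k m l assume h: "m \<noteq> l" "active a (recip p) j = - {m}" "active a (recip p) k = - {l}"
      then obtain i where "m \<noteq> i" "l \<noteq> i" by (meson obtain_third)
      then show ?thesis using main[OF R pos, of i l m j k] h by auto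
    qed
  qed
  then show ?thesis by (rule finite_subset) simp
qed

section \<open>Breakpoints, vertices and arcs along a segment\<close>

lemma mem_active_iff_break: "m \<in> active a \<gamma> j \<longleftrightarrow> break_at a \<gamma> m j \<le> \<gamma> $ m"
  using MAC[of m j] by (simp add: active_def top_value_others[of a \<gamma> j m] break_at_def field_simps max_def)

text \<open>Strictness marks the contrast with \<open>mem_active_iff_break\<close>: exactly at the
  breakpoint, \<open>m\<close> is active but not alone.\<close>

lemma active_singleton_iff_break: "active a \<gamma> j = {m} \<longleftrightarrow> break_at a \<gamma> m j < \<gamma> $ m"
proof -
  obtain i l where d: "i \<noteq> l" "i \<noteq> m" "l \<noteq> m" by (rule obtain_other_two)
  have "active a \<gamma> j = {m} \<longleftrightarrow> m \<in> active a \<gamma> j \<and> i \<notin> active a \<gamma> j \<and> l \<notin> active a \<gamma> j"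
    using d by (auto simp: set_3_eq_iff[OF d])
  also have "\<dots> \<longleftrightarrow> others_value a \<gamma> m j < \<gamma> $ m * a $ m $ j"
    by (auto simp: active_def top_value_unfold[OF d] others_value_eq[OF d] max_def)
  also have "\<dots> \<longleftrightarrow> break_at a \<gamma> m j < \<gamma> $ m"
    using MAC[of m j] by (simp add: break_at_def field_simps)
  finally show ?thesis .
qed

lemma break_at_pos:
  assumes "\<And>i. \<gamma> $ i > 0"
  shows "break_at a \<gamma> m j > 0"
proof -
  obtain i l where d: "i \<noteq> l" "i \<noteq> m" "l \<noteq> m" by (rule obtain_other_two)
  then show ?thesis using assms MAC by (simp add: break_at_def others_value_eq[OF d] less_max_iff_disj)
qed

text \<open>Every player shares a maximum at a vertex: for any good with a full tie, or, at a
  crossing, for the good whose segment leads to a corner other than \<open>m\<close>.\<close>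

lemma graph_vert_break:
  assumes "p \<in> graph_verts a"
  shows "\<exists>k. break_at a (recip p) m k = recip p $ m"
proof -
  obtain k i where "m \<in> active a (recip p) k" "i \<in> active a (recip p) k" "i \<noteq> m"
  proof -
    obtain x y where d: "x \<noteq> y" "x \<noteq> m" "y \<noteq> m" by (rule obtain_other_two)
    have "(\<exists>j. active a (recip p) j = UNIV) \<or>
     (\<exists>j k m l. m \<noteq> l \<and> active a (recip p) j = - {m} \<and> active a (recip p) k = - {l})"
      using assms by (simp add: graph_verts_iff)
    moreover have "\<exists>i. i \<noteq> m \<and> i \<noteq> l" if "l \<noteq> m" for l using d by metis
    ultimately show ?thesis using that d by (metis ComplI UNIV_I singletonD)
  qed
  then have "break_at a (recip p) m k \<le> recip p $ m" "\<not> break_at a (recip p) m k < recip p $ m"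
    unfolding mem_active_iff_break[symmetric] active_singleton_iff_break[symmetric] by auto
  then show ?thesis by (metis antisym_conv2)
qed

text \<open>Up to its breakpoint for \<open>j\<close>, player \<open>m\<close> does not exceed the
  others, so their tie persists and the motion stays on the segment of \<open>j\<close>.\<close>

lemma active_set_coord_superset:
  assumes "- {m} \<subseteq> active a \<gamma> j" "s \<le> break_at a \<gamma> m j"
  shows "- {m} \<subseteq> active a (set_coord \<gamma> m s) j"
proof -
  obtain i l where d: "i \<noteq> l" "i \<noteq> m" "l \<noteq> m" by (rule obtain_other_two)
  have "s * a $ m $ j \<le> others_value a \<gamma> m j" using assms(2) MAC[of m j]
    by (simp add: break_at_def field_simps)
  then show ?thesis using assms(1) d
    by (auto simp: Compl_singleton_3[OF d] active_iff all_3_iff[OF d] set_coord_nth others_value_eq[OF d])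
qed

text \<open>At the breakpoint for \<open>k\<close>, player \<open>m\<close> ties with some other
  player for \<open>k\<close>, while the other two still tie for \<open>j\<close>. This is a full
  tie or a crossing of segments towards different corners.\<close>

lemma break_point_in_graph_verts:
  assumes pos: "\<And>i. \<gamma> $ i > 0" and j: "- {m} \<subseteq> active a \<gamma> j"
    and s: "s = break_at a \<gamma> m k" "s \<le> break_at a \<gamma> m j"
  shows "normalize_vec (recip (set_coord \<gamma> m s)) \<in> graph_verts a"
proof -
  define \<gamma>' where "\<gamma>' = set_coord \<gamma> m s"
  have "s > 0" using s break_at_pos[OF pos] by simp
  then have pos': "\<gamma>' $ i > 0" for i using pos by (simp add: \<gamma>'_def set_coord_pos)
  have jm: "- {m} \<subseteq> active a \<gamma>' j" using active_set_coord_superset[OF j s(2)] by (simp add: \<gamma>'_def)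
  have mk: "m \<in> active a \<gamma>' k" "active a \<gamma>' k \<noteq> {m}"
    unfolding mem_active_iff_break active_singleton_iff_break
    by (simp_all add: \<gamma>'_def break_at_set_coord set_coord_nth s)
  have "(\<exists>j. active a \<gamma>' j = UNIV) \<or>
     (\<exists>j k m l. m \<noteq> l \<and> active a \<gamma>' j = - {m} \<and> active a \<gamma>' k = - {l})"
  proof (rule ccontr)
    assume n: "\<not> ?thesis"
    obtain i where i: "i \<noteq> m" "i \<in> active a \<gamma>' k" using mk by blast
    obtain l where l: "i \<noteq> l" "m \<noteq> l" using obtain_third[OF i(1)] by metis
    have d: "i \<noteq> m" "i \<noteq> l" "m \<noteq> l" using i l by auto
    have "active a \<gamma>' j \<noteq> UNIV" using n by simp
    then have "active a \<gamma>' j = - {m}" using jm by (simp add: Compl_singleton_subset_iff)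
    moreover have "active a \<gamma>' k = UNIV \<or> active a \<gamma>' k = - {l}"
      using mk(1) i(2) d by (cases "l \<in> active a \<gamma>' k") (auto simp: set_3_eq_iff[OF d])
    ultimately show False using n l by blast
  qed
  moreover have "normalize_vec (recip \<gamma>') $ i > 0" "normalize_vec (recip \<gamma>') \<in> RNS" for i
    using pos' by (auto intro: normalize_vec_pos normalize_vec_in_RNS)
  ultimately show ?thesis
    unfolding \<gamma>'_def[symmetric] graph_verts_iff using active_normalize_recip[of \<gamma>' a] pos' by simp
qed

text \<open>A vertex strictly between \<open>v\<close> and \<open>w\<close> would, by
  \<open>graph_vert_break\<close>, give a breakpoint strictly between the two values of coordinate
  \<open>m\<close>.\<close>

lemma graph_adj_along_line:
  assumes v: "v \<in> graph_verts a" and w: "w \<in> graph_verts a"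
    and \<gamma>: "\<gamma> = recip v" and w_eq: "w = normalize_vec (recip (set_coord \<gamma> m s))"
    and s: "0 < s" "s \<noteq> \<gamma> $ m"
    and j: "- {m} \<subseteq> active a \<gamma> j" "s \<le> break_at a \<gamma> m j"
    and between: "\<And>k. \<not> (min s (\<gamma> $ m) < break_at a \<gamma> m k \<and> break_at a \<gamma> m k < max s (\<gamma> $ m))"
  shows "graph_adj a v w"
proof -
  have v_pos: "v $ i > 0" and w_pos: "w $ i > 0" for i
    using v w by (simp_all add: graph_verts_pos)
  have pos: "\<gamma> $ i > 0" for i using v_pos by (simp add: \<gamma>)
  have pos': "set_coord \<gamma> m s $ i > 0" for i using pos s by (simp add: set_coord_pos)
  obtain c where c: "c > 0" "recip w = c *\<^sub>R set_coord \<gamma> m s"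
    using recip_normalize_recip[OF pos'] w_eq by auto
  have w_nth: "w $ x = (if x = m then 1 / (c * s) else v $ x / c)" for x
  proof -
    have "w $ x = 1 / (recip w $ x)" by simp
    also have "\<dots> = (if x = m then 1 / (c * s) else v $ x / c)"
      unfolding c(2) by (simp add: set_coord_nth \<gamma>)
    finally show ?thesis .
  qed
  have "v \<noteq> w"
  proof
    assume "v = w"
    obtain i where "i \<noteq> m" by (rule obtain_other_two)
    then have "c = 1" using w_nth[of i] \<open>v = w\<close> v_pos[of i] c(1) by (simp add: field_simps)
    then have "v $ m = 1 / s" using w_nth[of m] \<open>v = w\<close> by simp
    then show False using s by (simp add: \<gamma>)
  qed
  moreover have "v \<in> supp_segment a j m"
    using supp_segment_iff[OF graph_verts_subset_RNS[OF v] v_pos] j(1) by (simp add: \<gamma>)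
  moreover have "w \<in> supp_segment a j m"
    using supp_segment_iff[OF graph_verts_subset_RNS[OF w] w_pos]
      active_set_coord_superset[OF j] active_normalize_recip[OF pos', of a] by (simp add: w_eq)
  moreover have "open_segment v w \<inter> graph_verts a = {}"
  proof (rule ccontr)
    assume "open_segment v w \<inter> graph_verts a \<noteq> {}"
    then obtain p where p: "p \<in> graph_verts a" "p \<in> open_segment v w" by blast
    from p(2) obtain u where u: "0 < u" "u < 1" "p = (1 - u) *\<^sub>R v + u *\<^sub>R w"
      unfolding in_segment by blast
    \<comment> \<open>Rescaling \<open>recip p\<close> to agree with \<open>\<gamma>\<close> off
      \<open>m\<close> gives entry \<open>s'\<close> at \<open>m\<close>. The weights
      \<open>1 - u\<close> and \<open>u / c\<close> account for the different scaling of
      \<open>v\<close> and \<open>w\<close>.\<close>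
    define s' where "s' = ((1 - u) + u / c) / ((1 - u) / \<gamma> $ m + (u / c) / s)"
    define D where "D = (1 - u) + u / c"
    have D: "D > 0" using u c(1) by (simp add: D_def add_pos_pos)
    have "p $ m = (1 - u) / \<gamma> $ m + (u / c) / s"
      by (simp add: u w_nth \<gamma>)
    then have pm: "p $ m = D / s'" using D by (simp add: s'_def D_def)
    have px: "p $ x = D * v $ x" if "x \<noteq> m" for x
      using that by (simp add: u w_nth D_def algebra_simps)
    have "recip p = (1 / D) *\<^sub>R set_coord \<gamma> m s'"
      using D pm px by (auto simp: vec_eq_iff set_coord_nth \<gamma>)
    moreover obtain k where "break_at a (recip p) m k = recip p $ m"
      using graph_vert_break[OF p(1)] by blast
    ultimately have k: "break_at a \<gamma> m k = s'"
      using D break_at_scale[of "1 / D" a "set_coord \<gamma> m s'" m k]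
      by (simp add: break_at_set_coord set_coord_nth)
    have AB: "1 - u > 0" "u / c > 0" using u c(1) by auto
    show False
    proof (cases "\<gamma> $ m < s")
      case True
      then show False using between[of k] harmonic_mean_between[OF AB pos True]
        unfolding k s'_def by simp
    next
      case False
      then have "s < \<gamma> $ m" using s by simp
      then show False using between[of k] harmonic_mean_between[OF AB(2,1) s(1), of "\<gamma> $ m"]
        unfolding k s'_def by (simp add: add.commute)
    qed
  qed
  ultimately show ?thesis unfolding graph_adj_def using v w by blast
qed

section \<open>Change of \<open>g\<close> up to the next breakpoint and improving neighbours\<close>

text \<open>With no breakpoint passed, goods on which \<open>m\<close> alone is active shrink in
  proportion to coordinate \<open>m\<close>, and all other maxima stay at the value of the other
  players.\<close>

lemma g_set_coord_less:
  assumes "\<gamma> $ m > 0" "s < \<gamma> $ m"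
    and between: "\<And>k. \<not> (s < break_at a \<gamma> m k \<and> break_at a \<gamma> m k < \<gamma> $ m)"
  shows "g a (set_coord \<gamma> m s) =
    g a \<gamma> - (\<gamma> $ m - s) / \<gamma> $ m * (\<Sum>j\<in>UNIV. if active a \<gamma> j = {m} then top_value a \<gamma> j else 0)"
proof -
  have "top_value a (set_coord \<gamma> m s) j = top_value a \<gamma> j -
    (\<gamma> $ m - s) / \<gamma> $ m * (if active a \<gamma> j = {m} then top_value a \<gamma> j else 0)" for j
  proof (cases "active a \<gamma> j = {m}")
    case True
    then have "break_at a \<gamma> m j \<le> s" using between[of j] by (simp add: active_singleton_iff_break)
    then have "top_value a (set_coord \<gamma> m s) j = s * a $ m $ j"
      using MAC[of m j]
      by (simp add: top_value_others[of a _ j m] others_value_set_coord set_coord_nth break_at_def field_simps)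
    moreover have "top_value a \<gamma> j = \<gamma> $ m * a $ m $ j"
      using active_top[of m a \<gamma> j] True by simp
    ultimately show ?thesis using True assms(1) by (simp add: field_simps)
  next
    case False
    then have "\<gamma> $ m * a $ m $ j \<le> others_value a \<gamma> m j"
      using MAC[of m j] by (simp add: active_singleton_iff_break break_at_def field_simps)
    moreover have "s * a $ m $ j \<le> \<gamma> $ m * a $ m $ j" using assms(2) MAC[of m j] by simp
    ultimately show ?thesis using False
      by (simp add: top_value_others[of a _ j m] others_value_set_coord set_coord_nth)
  qed
  then show ?thesis by (simp add: g_eq_sum_top sum_subtractf sum_distrib_left)
qed

text \<open>When raising, shared maxima grow as well, so every good with \<open>m\<close> active
  counts; the others change no earlier than at the next breakpoint.\<close>

lemma g_set_coord_greater:
  assumes "\<gamma> $ m > 0" "\<gamma> $ m < s"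
    and between: "\<And>k. \<not> (\<gamma> $ m < break_at a \<gamma> m k \<and> break_at a \<gamma> m k < s)"
  shows "g a (set_coord \<gamma> m s) =
    g a \<gamma> + (s - \<gamma> $ m) / \<gamma> $ m * (\<Sum>j\<in>UNIV. if m \<in> active a \<gamma> j then top_value a \<gamma> j else 0)"
proof -
  have "top_value a (set_coord \<gamma> m s) j = top_value a \<gamma> j +
    (s - \<gamma> $ m) / \<gamma> $ m * (if m \<in> active a \<gamma> j then top_value a \<gamma> j else 0)" for j
  proof (cases "m \<in> active a \<gamma> j")
    case True
    then have "break_at a \<gamma> m j \<le> s" using assms(2) by (simp add: mem_active_iff_break)
    then have "top_value a (set_coord \<gamma> m s) j = s * a $ m $ j"
      using MAC[of m j]
      by (simp add: top_value_others[of a _ j m] others_value_set_coord set_coord_nth break_at_def field_simps)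
    moreover have "top_value a \<gamma> j = \<gamma> $ m * a $ m $ j"
      using active_top[of m a \<gamma> j] True by simp
    ultimately show ?thesis using True assms(1) by (simp add: field_simps)
  next
    case False
    then have "s \<le> break_at a \<gamma> m j" using between[of j] by (simp add: mem_active_iff_break)
    then have "s * a $ m $ j \<le> others_value a \<gamma> m j"
      using MAC[of m j] by (simp add: break_at_def field_simps)
    moreover have "\<gamma> $ m * a $ m $ j \<le> s * a $ m $ j" using assms(2) MAC[of m j] by simp
    ultimately show ?thesis using False
      by (simp add: top_value_others[of a _ j m] others_value_set_coord set_coord_nth)
  qed
  then show ?thesis by (simp add: g_eq_sum_top sum.distrib sum_distrib_left)
qed

lemma g_tilde_pos:
  assumes "v \<in> graph_verts a"
  shows "g_tilde a v > 0"
proof -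
  have v: "v $ i > 0" for i using assms by (simp add: graph_verts_pos)
  have "top_value a (recip v) j > 0" for j
    using top_value_ge[of "recip v" 1 a j] v[of 1] MAC[of 1 j]
    by (smt (verit) divide_pos_pos mult_pos_pos recip_nth)
  then have "g a (recip v) > 0" by (auto simp: g_eq_sum_top intro: sum_pos)
  then show ?thesis using v sum_nth_pos[of "recip v"] by (simp add: g_tilde_eq)
qed

text \<open>Coordinate \<open>m\<close> is lowered to the nearest breakpoint below. Lowering
  preserves the tie of the other two for \<open>j\<close>, so the motion follows a segment whether
  or not \<open>m\<close> is active.\<close>

lemma improving_neighbour_down:
  assumes v: "v \<in> graph_verts a" and \<gamma>: "\<gamma> = recip v" and t: "t = g_tilde a v"
    and slope: "slope_down a t \<gamma> m < 0" and j: "- {m} \<subseteq> active a \<gamma> j"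
  shows "\<exists>w. graph_adj a v w \<and> g_tilde a w < g_tilde a v"
proof -
  have pos: "\<gamma> $ i > 0" for i using graph_verts_pos[OF v] by (simp add: \<gamma>)
  have g: "g a \<gamma> = t * sum (($) \<gamma>) UNIV"
    using sum_nth_pos[OF pos] graph_verts_pos[OF v] by (simp add: t g_tilde_eq \<gamma>)
  define B where "B = {b \<in> range (break_at a \<gamma> m). b < \<gamma> $ m}"
  \<comment> \<open>Without a breakpoint below, no good has \<open>m\<close> alone active, and the
    slope would be the positive number \<open>t * \<gamma> $ m\<close>.\<close>
  have "B \<noteq> {}"
  proof
    assume "B = {}"
    then have "active a \<gamma> k \<noteq> {m}" for k unfolding active_singleton_iff_break B_def by blast
    then show False using slope pos[of m] g_tilde_pos[OF v] by (auto simp: slope_down_def t mult_less_0_iff)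
  qed
  define s where "s = Max B"
  have "finite B" by (simp add: B_def)
  have "s \<in> B" unfolding s_def by (rule Max_in) fact+
  then obtain k where k: "s = break_at a \<gamma> m k" and s: "s < \<gamma> $ m" by (auto simp: B_def)
  have "s > 0" using k break_at_pos[OF pos] by simp
  have between: "\<not> (s < break_at a \<gamma> m k \<and> break_at a \<gamma> m k < \<gamma> $ m)" for k
  proof -
    have "break_at a \<gamma> m k \<in> B" if "break_at a \<gamma> m k < \<gamma> $ m" using that by (simp add: B_def)
    then show ?thesis using Max_ge[OF \<open>finite B\<close>, of "break_at a \<gamma> m k"] unfolding s_def by linarith
  qed
  have "\<gamma> $ m \<le> break_at a \<gamma> m j"
  proof -
    obtain i where "i \<noteq> m" by (rule obtain_other_two)
    then have "active a \<gamma> j \<noteq> {m}" using j by auto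
    then show ?thesis by (simp add: active_singleton_iff_break)
  qed
  with s have sj: "s \<le> break_at a \<gamma> m j" by simp
  define w where "w = normalize_vec (recip (set_coord \<gamma> m s))"
  have "w \<in> graph_verts a"
    unfolding w_def by (rule break_point_in_graph_verts[OF pos j k sj])
  then have "graph_adj a v w"
    using graph_adj_along_line[OF v _ \<gamma> w_def \<open>s > 0\<close> _ j sj] between s by simp
  moreover have "g_tilde a w < t"
  proof -
    have pos': "set_coord \<gamma> m s $ i > 0" for i using pos \<open>s > 0\<close> by (simp add: set_coord_pos)
    \<comment> \<open>The excess of \<open>g a\<close> over \<open>t\<close> times the coordinate
      sum vanishes at \<open>\<gamma>\<close> and is linear as far as \<open>s\<close>.\<close>
    have "g a (set_coord \<gamma> m s) - t * sum (($) (set_coord \<gamma> m s)) UNIV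
        = (\<gamma> $ m - s) / \<gamma> $ m * slope_down a t \<gamma> m"
      using pos[of m]
      by (simp add: g_set_coord_less[OF pos s between] g sum_set_coord slope_down_def field_simps)
    also have "\<dots> < 0" using slope s pos[of m] by (intro mult_pos_neg) auto
    finally show ?thesis
      using sum_nth_pos[OF pos'] by (simp add: w_def g_tilde_normalize_recip[OF pos'] pos_divide_less_eq)
  qed
  ultimately show ?thesis using t by blast
qed

text \<open>Raising coordinate \<open>m\<close> stays on the segment of \<open>j\<close> only while
  \<open>m\<close> is below the tie, hence the exact active set. The breakpoint for \<open>j\<close>
  lies above, so a nearest one exists and is reached no later.\<close>

lemma improving_neighbour_up:
  assumes v: "v \<in> graph_verts a" and \<gamma>: "\<gamma> = recip v" and t: "t = g_tilde a v"
    and slope: "slope_up a t \<gamma> m < 0" and j: "active a \<gamma> j = - {m}"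
  shows "\<exists>w. graph_adj a v w \<and> g_tilde a w < g_tilde a v"
proof -
  have pos: "\<gamma> $ i > 0" for i using graph_verts_pos[OF v] by (simp add: \<gamma>)
  have g: "g a \<gamma> = t * sum (($) \<gamma>) UNIV"
    using sum_nth_pos[OF pos] graph_verts_pos[OF v] by (simp add: t g_tilde_eq \<gamma>)
  define B where "B = {b \<in> range (break_at a \<gamma> m). \<gamma> $ m < b}"
  have "m \<notin> active a \<gamma> j" using j by simp
  then have jB: "break_at a \<gamma> m j \<in> B" by (simp add: B_def mem_active_iff_break)
  define s where "s = Min B"
  have "finite B" by (simp add: B_def)
  have "s \<in> B" unfolding s_def by (rule Min_in) (use \<open>finite B\<close> jB in auto)
  then obtain k where k: "s = break_at a \<gamma> m k" and s: "\<gamma> $ m < s" by (auto simp: B_def)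
  have "s > 0" using k break_at_pos[OF pos] by simp
  have between: "\<not> (\<gamma> $ m < break_at a \<gamma> m k \<and> break_at a \<gamma> m k < s)" for k
  proof -
    have "break_at a \<gamma> m k \<in> B" if "\<gamma> $ m < break_at a \<gamma> m k" using that by (simp add: B_def)
    then show ?thesis using Min_le[OF \<open>finite B\<close>, of "break_at a \<gamma> m k"] unfolding s_def by linarith
  qed
  have sj: "s \<le> break_at a \<gamma> m j" unfolding s_def using \<open>finite B\<close> jB by (rule Min_le)
  have j': "- {m} \<subseteq> active a \<gamma> j" using j by simp
  define w where "w = normalize_vec (recip (set_coord \<gamma> m s))"
  have "w \<in> graph_verts a"
    unfolding w_def by (rule break_point_in_graph_verts[OF pos j' k sj])
  then have "graph_adj a v w"
    using graph_adj_along_line[OF v _ \<gamma> w_def \<open>s > 0\<close> _ j' sj] between s by simp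
  moreover have "g_tilde a w < t"
  proof -
    have pos': "set_coord \<gamma> m s $ i > 0" for i using pos \<open>s > 0\<close> by (simp add: set_coord_pos)
    have "g a (set_coord \<gamma> m s) - t * sum (($) (set_coord \<gamma> m s)) UNIV
        = (s - \<gamma> $ m) / \<gamma> $ m * slope_up a t \<gamma> m"
      using pos[of m]
      by (simp add: g_set_coord_greater[OF pos s between] g sum_set_coord slope_up_def field_simps)
    also have "\<dots> < 0" using slope s pos[of m] by (intro mult_pos_neg) auto
    finally show ?thesis
      using sum_nth_pos[OF pos'] by (simp add: w_def g_tilde_normalize_recip[OF pos'] pos_divide_less_eq)
  qed
  ultimately show ?thesis using t by blast
qed

section \<open>From the stopping test to optimality, and termination\<close>

text \<open>If an improving single-coordinate move at \<open>p\<close> follows no segment, it splits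
  into opposite moves at \<open>q\<close> and \<open>r\<close>. The ties present at a vertex ensure
  that these follow segments, and one of them must improve.\<close>

lemma exists_improving_slope_along_edge:
  assumes v: "v \<in> graph_verts a" and \<gamma>: "\<gamma> = recip v"
    and t: "t * sum (($) \<gamma>) UNIV = g a \<gamma>"
    and less: "g a \<delta> < t * sum (($) \<delta>) UNIV"
  shows "\<exists>m j. slope_down a t \<gamma> m < 0 \<and> - {m} \<subseteq> active a \<gamma> j \<or>
    slope_up a t \<gamma> m < 0 \<and> active a \<gamma> j = - {m}"
proof (rule ccontr)
  assume n: "\<not> ?thesis"
  then have nd: "slope_down a t \<gamma> m < 0 \<Longrightarrow> \<not> - {m} \<subseteq> active a \<gamma> j"
    and nu: "slope_up a t \<gamma> m < 0 \<Longrightarrow> active a \<gamma> j \<noteq> - {m}" for m j by blast+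
  have pos: "\<gamma> $ i > 0" for i using graph_verts_pos[OF v] by (simp add: \<gamma>)
  obtain p where p: "slope_up a t \<gamma> p < 0 \<or> slope_down a t \<gamma> p < 0"
    using exists_improving_slope[OF pos t less] by blast
  obtain q r where "q \<noteq> r" "q \<noteq> p" "r \<noteq> p" by (rule obtain_other_two)
  then have d: "p \<noteq> q" "p \<noteq> r" "q \<noteq> r" and C: "- {p} = {q, r}" "- {q} = {p, r}" "- {r} = {p, q}"
    using Compl_singleton_3 by metis+
  have up: "slope_up a t \<gamma> p = slope_down a t \<gamma> q + slope_down a t \<gamma> r" if "slope_up a t \<gamma> p < 0"
    using slope_up_split[OF d t] nu[OF that] C by metis
  have down: "slope_down a t \<gamma> p = slope_up a t \<gamma> q + slope_up a t \<gamma> r" if "slope_down a t \<gamma> p < 0"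
    using slope_down_split[OF d t] nd[OF that] C by metis
  have "(\<exists>j. active a \<gamma> j = UNIV) \<or> (\<exists>j k m l. m \<noteq> l \<and> active a \<gamma> j = - {m} \<and> active a \<gamma> k = - {l})"
    using v by (simp add: graph_verts_iff \<gamma>)
  then show False
  proof (elim disjE exE conjE)
    fix j assume "active a \<gamma> j = UNIV"
    \<comment> \<open>At a full tie every lowering follows a segment, so only raising
      \<open>p\<close> could improve, and it splits into two lowerings.\<close>
    then have "slope_down a t \<gamma> m \<ge> 0" for m using nd[of m j] by force
    then show False using p up by (smt (verit))
  next
    fix j k m l assume ml: "m \<noteq> l" "active a \<gamma> j = - {m}" "active a \<gamma> k = - {l}"
    \<comment> \<open>At a crossing, both signs of motion at \<open>m\<close> and at
      \<open>l\<close> follow segments. So \<open>p\<close> is the third player, and its move splits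
      into moves at \<open>m\<close> and \<open>l\<close>.\<close>
    then have nn: "slope_down a t \<gamma> x \<ge> 0 \<and> slope_up a t \<gamma> x \<ge> 0" if "x = m \<or> x = l" for x
      using nd[of x] nu[of x] that by (metis linorder_not_less order_refl)
    have "p \<noteq> m" "p \<noteq> l" using nn[of p] p by auto
    then have "q = m \<or> q = l" "r = m \<or> r = l" using ml(1) UNIV_3_eq[OF d] by (metis UNIV_I insertE singletonD)+
    then show False using nn[of q] nn[of r] up down p by linarith
  qed
qed

lemma alg_stops_optimal:
  assumes v: "v \<in> graph_verts a" and stop: "alg_stops a v"
  shows "optimal_vertex a v"
proof (rule optimal_vertexI[OF v])
  show v_pos: "v $ i > 0" for i by (rule graph_verts_pos[OF v])
  show "0 \<le> g_tilde a v" using g_tilde_pos[OF v] by simp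
  have "sum (($) (recip v)) UNIV > 0" by (rule sum_nth_pos) (simp add: v_pos)
  then have t: "g_tilde a v * sum (($) (recip v)) UNIV = g a (recip v)"
    using v_pos by (simp add: g_tilde_eq)
  show "g_tilde a v * sum (($) \<delta>) UNIV \<le> g a \<delta>" for \<delta>
  proof (rule ccontr)
    assume "\<not> ?thesis"
    then have "g a \<delta> < g_tilde a v * sum (($) \<delta>) UNIV" by simp
    then have "\<exists>w. graph_adj a v w \<and> g_tilde a w < g_tilde a v"
      using exists_improving_slope_along_edge[OF v refl t]
        improving_neighbour_down[OF v refl refl] improving_neighbour_up[OF v refl refl] by blast
    then show False using stop unfolding alg_stops_def by (meson linorder_not_less)
  qed
qed

lemma alg_step_exists:
  assumes "\<not> alg_stops a v"
  shows "\<exists>w. alg_step a v w"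
proof -
  define A where "A = {w. graph_adj a v w}"
  have "finite A" "A \<noteq> {}"
    using assms finite_subset[OF _ finite_graph_verts, of A]
    by (auto simp: A_def graph_adj_def alg_stops_def)
  then obtain w where "w \<in> A" "\<And>u. u \<in> A \<Longrightarrow> g_tilde a w \<le> g_tilde a u"
    using ex_min_if_finite[of "g_tilde a ` A"] by (force simp: not_less)
  then show ?thesis using assms by (auto simp: alg_step_def A_def)
qed

text \<open>Strictly decreasing values of \<open>g_tilde\<close> forbid revisiting a vertex, and the
  vertex set is finite.\<close>

lemma no_infinite_run: "\<not> (\<forall>k. alg_step a (v k) (v (Suc k)))"
proof
  assume st: "\<forall>k. alg_step a (v k) (v (Suc k))"
  have mono: "strict_mono (\<lambda>k. - g_tilde a (v k))"
    using st alg_step_decreases by (auto simp: strict_mono_Suc_iff)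
  have "inj v"
  proof (rule injI)
    fix x y assume "v x = v y"
    then show "x = y" using strict_mono_eq[OF mono, of x y] by simp
  qed
  moreover have "v k \<in> graph_verts a" for k
    using st by (auto simp: alg_step_def graph_adj_def)
  ultimately show False
    using finite_subset[OF _ finite_graph_verts, of "range v"] finite_imageD[of v UNIV] by auto
qed

end

theorem theorem8:
  fixes a :: "real^'m^3"
  assumes normalized: "\<And>i. (\<Sum>j\<in>UNIV. a $ i $ j) = 1"
    and MAC: "\<And>i j. a $ i $ j > 0"
    and start: "v0 \<in> graph_verts a"
  shows "\<not> (\<exists>v :: nat \<Rightarrow> real^3. v 0 = v0 \<and> (\<forall>k. alg_step a (v k) (v (Suc k))))
       \<and> (\<forall>v. (alg_step a)\<^sup>*\<^sup>* v0 v \<and> \<not> alg_stops a v \<longrightarrow> (\<exists>w. alg_step a v w))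
       \<and> (\<forall>v. (alg_step a)\<^sup>*\<^sup>* v0 v \<and> alg_stops a v \<longrightarrow> optimal_vertex a v)"
proof (intro conjI allI impI)
  \<comment> \<open>Ties make the algorithm a relation, so finiteness has to be shown for every way
    of resolving them.\<close>
  show "\<not> (\<exists>v :: nat \<Rightarrow> real^3. v 0 = v0 \<and> (\<forall>k. alg_step a (v k) (v (Suc k))))"
    using no_infinite_run[OF MAC] by blast
  show "\<exists>w. alg_step a v w" if "(alg_step a)\<^sup>*\<^sup>* v0 v \<and> \<not> alg_stops a v" for v
    using that alg_step_exists[OF MAC] by blast
  show "optimal_vertex a v" if "(alg_step a)\<^sup>*\<^sup>* v0 v \<and> alg_stops a v" for v
  proof -
    have "v \<in> graph_verts a"
      using that start by (metis alg_step_graph_verts rtranclp.cases)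
    then show ?thesis using that alg_stops_optimal[OF MAC] by blast
  qed
qed

end
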